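(* Let the system, the processes $x_t,u_t,w_t$, the $\sigma$-algebras $\mathcal{F}_t$, the matrices $Q_{ij}$, and the quantities $\Delta_t, d_t, \Sigma, \gamma, \delta$ be as in the context. Assume that for every $t\in\{0,\dots,N-1\}$: (A1) $u_t\in\mathcal{L}^2(\mathcal{F}_t)$, and (A2) $\mathbb{E}(|w_t|^4)<\infty$. Let $t\in\{1,\dots,N\}$ be given. Define $$y_t := x_t^\top Q_{00}x_t-\mathbb{E}(x_t^\top Q_{00}x_t\mid\mathcal{F}_{t-1}),\qquad \Delta_{t,1}:=y_t^2,$$ and, if $\mathbf{k}_t\ge 1$, $$\Delta_{t,2}:=4\Big(\sum_{i=1}^{\mathbf{k}_t}x_{t-i}^\top Q_{i0}d_t\Big)^2,\qquad \Delta_{t,3}:=4\sum_{i=1}^{\mathbf{k}_t}x_{t-i}^\top Q_{i0}d_t\,y_t .$$ Let $\vartheta:=\delta-4\,\mathrm{tr}((\Sigma Q_{00})^2)$. If $\mathbf{k}_t\ge 1$, then $$\Delta_t^2=\Delta_{t,1}+\Delta_{t,2}+\Delta_{t,3}\quad\text{a.s.},$$ where each term on the right-hand side is integrable, and $$\mathbb{E}(\Delta_{t,1})=4\,\mathbb{E}\big(x_t^\top Q_{00}\Sigma Q_{00}x_t+x_t^\top Q_{00}\gamma\big)+\vartheta,\qquad(\ast)$$ $$\mathbb{E}(\Delta_{t,2})=4\sum_{i=1}^{\mathbf{k}_t}\sum_{j=1}^{\mathbf{k}_t}\mathbb{E}\big(x_{t-i}^\top Q_{i0}\Sigma Q_{0j}x_{t-j}\big),$$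 $$\mathbb{E}(\Delta_{t,3})=4\sum_{i=1}^{\mathbf{k}_t}\mathbb{E}\big(x_{t-i}^\top Q_{i0}(\gamma+2\Sigma Q_{00}x_t)\big).$$ If $\mathbf{k}_t=0$, then $\Delta_t^2=\Delta_{t,1}$ is integrable and $\mathbb{E}(\Delta_t^2)$ is given by the right-hand side of $(\ast)$.
   Context: Notation: $\mathcal{S}_n$ is the set of $n\times n$ real symmetric positive semidefinite matrices; $|\cdot|$ is the Euclidean norm; $y\in\mathcal{L}^2(\mathcal{F})$ means $y$ is an $\mathcal{F}$-measurable random vector with $\mathbb{E}(|y|^2)<\infty$; $\sigma(\cdot)$ is the $\sigma$-algebra generated by a random vector; a.s. means almost surely. System: fix $N\in\mathbb{N}=\{1,2,\dots\}$ and deterministic matrices $A\in\mathbb{R}^{n\times n}$, $B\in\mathbb{R}^{n\times m}$. On a probability space $(\Omega,\mathcal{G},\mathbb{P})$, consider $$x_{t+1}=Ax_t+Bu_t+w_t,\quad t\in\{0,\dots,N-1\},$$ where $x_t$ (state) and $w_t$ (disturbance) are $\mathbb{R}^n$-valued random vectors and $u_t$ (control) is an $\mathbb{R}^m$-valued random vector. The random vectors $x_0,w_0,\dots,w_{N-1}$ are independent, $w_0,\dots,w_{N-1}$ are identically distributed, and $x_0=\mathbf{x}_0$ a.s. for an arbitrary deterministic $\mathbf{x}_0\in\mathbb{R}^n$. Define $\mathcal{F}_t:=\sigma(h_t)$, where $h_0:=x_0$ and $h_t:=[x_0^\top,u_0^\top,\dots,x_{t-1}^\top,u_{t-1}^\top,x_t^\top]^\top$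 for $t\in\{1,\dots,N\}$. Temporal coupling: fix a coupling length $\mathbf{k}\in\{0,\dots,N\}$ and a matrix $\mathcal{Q}\in\mathcal{S}_{n(\mathbf{k}+1)}$ partitioned into $n\times n$ blocks $Q_{ij}$, $i,j\in\{0,\dots,\mathbf{k}\}$ (block row $i$, block column $j$). For $t\in\{0,\dots,N\}$ let $\mathbf{k}_t:=\min\{\mathbf{k},t\}$, $n_t:=n(\mathbf{k}_t+1)$, $\eta_t:=[x_t^\top\;\cdots\;x_{t-\mathbf{k}_t}^\top]^\top$, let $\mathcal{Q}_t$ be the submatrix formed by the first $n_t$ rows and first $n_t$ columns of $\mathcal{Q}$, and let $z_t:=\eta_t^\top\mathcal{Q}_t\eta_t$. For $t\in\{1,\dots,N\}$ let $\Delta_t:=z_t-\mathbb{E}(z_t\mid\mathcal{F}_{t-1})$. Noise statistics (finite under the assumptions, and independent of $t$): $\bar w:=\mathbb{E}(w_{t-1})$, $d_t:=w_{t-1}-\bar w$ for $t\in\{1,\dots,N\}$, $\Sigma:=\mathbb{E}(d_td_t^\top)$, $\gamma:=\mathbb{E}(d_td_t^\top Q_{00}d_t)$, $\delta:=\mathrm{var}(d_t^\top Q_{00}d_t)$. *)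

theory Defs
  imports "HOL-Probability.Probability"
begin

text \<open>
  A matrix of size \<open>n (k + 1)\<close>, partitioned into \<open>n \<times> n\<close> blocks, is a function
  \<open>Q :: nat \<times> 'n \<Rightarrow> nat \<times> 'n \<Rightarrow> real\<close> whose rows and columns are indexed by pairs
  (block index, index inside the block) from the set \<open>block_index k\<close>; entries of \<open>Q\<close> outside
  this index set are never used.  Its leading submatrix of size \<open>n (l + 1)\<close>, \<open>l \<le> k\<close>, is
  the restriction of \<open>Q\<close> to \<open>block_index l\<close>.
\<close>

definition block_index :: "nat \<Rightarrow> (nat \<times> 'n::finite) set" where
  "block_index k = {..k} \<times> UNIV"

definition quad_form :: "'i set \<Rightarrow> ('i \<Rightarrow> 'i \<Rightarrow> real) \<Rightarrow> ('i \<Rightarrow> real) \<Rightarrow> real" where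
  "quad_form I Q v = (\<Sum>p\<in>I. \<Sum>q\<in>I. v p * Q p q * v q)"

definition sym_psd_on :: "'i set \<Rightarrow> ('i \<Rightarrow> 'i \<Rightarrow> real) \<Rightarrow> bool" where
  "sym_psd_on I Q \<longleftrightarrow> (\<forall>p\<in>I. \<forall>q\<in>I. Q p q = Q q p) \<and> (\<forall>v. 0 \<le> quad_form I Q v)"

definition blk :: "(nat \<times> 'n \<Rightarrow> nat \<times> 'n \<Rightarrow> real) \<Rightarrow> nat \<Rightarrow> nat \<Rightarrow> real^'n^'n::finite" where
  "blk Q i j = (\<chi> a b. Q (i, a) (j, b))"

text \<open>
  The \<open>\<sigma>\<close>-algebra generated by the history \<open>x\<^sub>0, u\<^sub>0, \<dots>, x\<^bsub>t-1\<^esub>, u\<^bsub>t-1\<^esub>, x\<^sub>t\<close>.  The history is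
  kept as the pair of the tuples \<open>(x\<^sub>0, \<dots>, x\<^sub>t)\<close> and \<open>(u\<^sub>0, \<dots>, u\<^bsub>t-1\<^esub>)\<close>, i.e. with its
  components reordered; the second tuple is empty for \<open>t = 0\<close>.
\<close>

definition hist_algebra ::
  "'a measure \<Rightarrow> (nat \<Rightarrow> 'a \<Rightarrow> real^'n::finite) \<Rightarrow> (nat \<Rightarrow> 'a \<Rightarrow> real^'m::finite) \<Rightarrow> nat \<Rightarrow> 'a measure"
  where
  "hist_algebra M x u t =
     vimage_algebra (space M)
       (\<lambda>\<omega>. (\<lambda>i\<in>{..t}. x i \<omega>, \<lambda>i\<in>{..<t}. u i \<omega>))
       ((\<Pi>\<^sub>M i\<in>{..t}. borel) \<Otimes>\<^sub>M (\<Pi>\<^sub>M i\<in>{..<t}. borel))"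

definition in_L2 :: "'a measure \<Rightarrow> 'a measure \<Rightarrow> ('a \<Rightarrow> 'b::euclidean_space) \<Rightarrow> bool" where
  "in_L2 M F y \<longleftrightarrow> y \<in> borel_measurable F \<and> integrable M (\<lambda>\<omega>. (norm (y \<omega>))\<^sup>2)"

definition eta :: "(nat \<Rightarrow> 'a \<Rightarrow> real^'n::finite) \<Rightarrow> nat \<Rightarrow> 'a \<Rightarrow> nat \<times> 'n \<Rightarrow> real" where
  "eta x t \<omega> = (\<lambda>(i, a). x (t - i) \<omega> $ a)"

definition zproc ::
  "(nat \<times> 'n \<Rightarrow> nat \<times> 'n \<Rightarrow> real) \<Rightarrow> nat \<Rightarrow> (nat \<Rightarrow> 'a \<Rightarrow> real^'n::finite) \<Rightarrow> nat \<Rightarrow> 'a \<Rightarrow> real"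
  where
  "zproc Q k x t \<omega> = quad_form (block_index (min k t)) Q (eta x t \<omega>)"

text \<open>\<open>innov M x u f t\<close> is \<open>f - E(f | F\<^bsub>t-1\<^esub>)\<close>; it is meant for \<open>t \<ge> 1\<close>.\<close>

definition innov ::
  "'a measure \<Rightarrow> (nat \<Rightarrow> 'a \<Rightarrow> real^'n::finite) \<Rightarrow> (nat \<Rightarrow> 'a \<Rightarrow> real^'m::finite) \<Rightarrow>
   ('a \<Rightarrow> real) \<Rightarrow> nat \<Rightarrow> 'a \<Rightarrow> real"
  where
  "innov M x u f t \<omega> = f \<omega> - real_cond_exp M (hist_algebra M x u (t - 1)) f \<omega>"

definition Delta where
  "Delta M Q k x u t = innov M x u (zproc Q k x t) t"

definition yproc where
  "yproc M Q x u t = innov M x u (\<lambda>\<omega>. x t \<omega> \<bullet> (blk Q 0 0 *v x t \<omega>)) t"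

text \<open>
  Since the disturbances are identically distributed, their statistics do not depend on time;
  they are defined through the first disturbance \<open>w 0\<close>, that is, through \<open>d\<^sub>1\<close>.
\<close>

definition wbar :: "'a measure \<Rightarrow> (nat \<Rightarrow> 'a \<Rightarrow> real^'n::finite) \<Rightarrow> real^'n" where
  "wbar M w = (\<integral>\<omega>. w 0 \<omega> \<partial>M)"

definition dist_dev ::
  "'a measure \<Rightarrow> (nat \<Rightarrow> 'a \<Rightarrow> real^'n::finite) \<Rightarrow> nat \<Rightarrow> 'a \<Rightarrow> real^'n" where
  "dist_dev M w t \<omega> = w (t - 1) \<omega> - wbar M w"

definition outer :: "real^'n::finite \<Rightarrow> real^'n \<Rightarrow> real^'n^'n" where
  "outer v w = (\<chi> a b. v $ a * w $ b)"

definition noise_cov :: "'a measure \<Rightarrow> (nat \<Rightarrow> 'a \<Rightarrow> real^'n::finite) \<Rightarrow> real^'n^'n" where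
  "noise_cov M w = (\<integral>\<omega>. outer (dist_dev M w 1 \<omega>) (dist_dev M w 1 \<omega>) \<partial>M)"

definition noise_gamma ::
  "'a measure \<Rightarrow> (nat \<Rightarrow> 'a \<Rightarrow> real^'n::finite) \<Rightarrow> real^'n^'n \<Rightarrow> real^'n" where
  "noise_gamma M w Q00 =
     (\<integral>\<omega>. outer (dist_dev M w 1 \<omega>) (dist_dev M w 1 \<omega>) *v (Q00 *v dist_dev M w 1 \<omega>) \<partial>M)"

definition noise_delta ::
  "'a measure \<Rightarrow> (nat \<Rightarrow> 'a \<Rightarrow> real^'n::finite) \<Rightarrow> real^'n^'n \<Rightarrow> real" where
  "noise_delta M w Q00 =
     prob_space.variance M (\<lambda>\<omega>. dist_dev M w 1 \<omega> \<bullet> (Q00 *v dist_dev M w 1 \<omega>))"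

definition noise_theta ::
  "'a measure \<Rightarrow> (nat \<Rightarrow> 'a \<Rightarrow> real^'n::finite) \<Rightarrow> real^'n^'n \<Rightarrow> real" where
  "noise_theta M w Q00 =
     noise_delta M w Q00 - 4 * trace ((noise_cov M w ** Q00) ** (noise_cov M w ** Q00))"

definition Delta1 where
  "Delta1 M Q x u t \<omega> = (yproc M Q x u t \<omega>)\<^sup>2"

definition Delta2 where
  "Delta2 M Q k x w t \<omega> =
     4 * (\<Sum>i = 1..min k t. x (t - i) \<omega> \<bullet> (blk Q i 0 *v dist_dev M w t \<omega>))\<^sup>2"

definition Delta3 where
  "Delta3 M Q k x u w t \<omega> =
     4 * (\<Sum>i = 1..min k t. x (t - i) \<omega> \<bullet> (blk Q i 0 *v dist_dev M w t \<omega>) * yproc M Q x u t \<omega>)"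

end

(* The state splits as x_t = v + d, where v = A x_{t-1} + B u_{t-1} + E(w_{t-1}) is F_{t-1}-measurable and
   d = d_t is centred and independent of F_{t-1}: unrolling the dynamics shows that F_{t-1} is
   contained in the sigma-algebra of x_0, w_0, ..., w_{t-2}. A variable of the form
   f + r . d + d . P d with f and r measurable with respect to F_{t-1} deviates from its conditional
   expectation by r . d + d . P d - E(d . P d). With s the sum of the Q_{0i} x_{t-i}, this gives
   y_t = 2 (Q00 v) . d + d . Q00 d - E(d . Q00 d) and Delta_t = y_t + 2 s . d, and the expectations
   follow from E((a . d)(b . d)) = E(a . Sigma b) and E((a . d)(d . P d)) = E(a) . gamma for
   square-integrable F_{t-1}-measurable a and b. Replacing v by x_t in the result
   adds E(d . Q00 Sigma Q00 d) = tr((Sigma Q00)^2), which is the origin of the correction in theta. *)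

theory Submission
  imports Defs
begin

section \<open>Measurability and integration of vectors by coordinates\<close>

lemma borel_measurable_vec_nth [measurable]:
  "f \<in> borel_measurable M \<Longrightarrow> (\<lambda>\<omega>. (f \<omega> :: real^'n) $ i) \<in> borel_measurable M"
  by (rule borel_measurable_continuous_on) (auto intro: continuous_intros)

lemma borel_measurable_matrix_vector_mult [measurable]:
  fixes P :: "real^'n^'m"
  assumes "f \<in> borel_measurable M"
  shows "(\<lambda>\<omega>. P *v f \<omega>) \<in> borel_measurable M"
  by (rule borel_measurable_continuous_on[OF _ assms])
    (rule linear_continuous_on[OF matrix_vector_mul_bounded_linear])

text \<open>The vector is the finite sum of its coordinates, each embedded by the bounded linear map
  \<open>axis i\<close>.\<close>

lemma integrable_vec:
  fixes f :: "'a \<Rightarrow> 'b::euclidean_space^'n"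
  assumes "\<And>i. integrable M (\<lambda>\<omega>. f \<omega> $ i)"
  shows "integrable M f"
proof -
  have ax: "bounded_linear (axis i :: 'b \<Rightarrow> 'b^'n)" for i :: 'n
    unfolding linear_conv_bounded_linear[symmetric]
    by (rule linearI) (auto simp: vec_eq_iff axis_def)
  have "integrable M (\<lambda>\<omega>. \<Sum>i\<in>UNIV. axis i (f \<omega> $ i))"
    by (intro Bochner_Integration.integrable_sum integrable_bounded_linear[OF ax] assms)
  also have "(\<lambda>\<omega>. \<Sum>i\<in>UNIV. axis i (f \<omega> $ i)) = f"
    by (auto simp: fun_eq_iff vec_eq_iff axis_def sum.delta if_distrib cong: if_cong)
  finally show ?thesis .
qed

lemma integral_vec_nth:
  fixes f :: "'a \<Rightarrow> 'b::euclidean_space^'n"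
  assumes "integrable M f"
  shows "(\<integral>\<omega>. f \<omega> \<partial>M) $ i = (\<integral>\<omega>. f \<omega> $ i \<partial>M)"
  by (rule integral_bounded_linear[OF bounded_linear_vec_nth assms, symmetric])

lemma integrable_vec_nth:
  fixes f :: "'a \<Rightarrow> 'b::euclidean_space^'n"
  assumes "integrable M f"
  shows "integrable M (\<lambda>\<omega>. f \<omega> $ i)"
  by (rule integrable_bounded_linear[OF bounded_linear_vec_nth assms])

lemma inner_matrix_vector_sum:
  fixes P :: "real^'n^'m"
  shows "v \<bullet> (P *v z) = (\<Sum>i\<in>UNIV. \<Sum>j\<in>UNIV. v $ i * P $ i $ j * z $ j)"
  by (simp add: inner_vec_def matrix_vector_mult_def sum_distrib_left mult.assoc)

lemma outer_matrix_vector_mult: "outer v z *v y = (z \<bullet> y) *\<^sub>R v"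
  by (simp add: vec_eq_iff outer_def matrix_vector_mult_def inner_vec_def sum_distrib_left
      mult_ac)

section \<open>Square-integrable vectors measurable with respect to a sub-\<sigma>-algebra\<close>

locale L2_space = prob_space M for M :: "'a measure" +
  fixes F :: "'a measure"
  assumes subalg: "subalgebra M F"
begin

sublocale finite_measure_subalgebra M F
  by unfold_locales (rule subalg)

lemma measurable_F_M: "f \<in> measurable F N \<Longrightarrow> f \<in> measurable M N"
  using subalg by (rule measurable_from_subalg)

lemma in_L2_measurable: "in_L2 M F f \<Longrightarrow> f \<in> borel_measurable F"
  by (simp add: in_L2_def)

lemma in_L2_I:
  fixes f :: "'a \<Rightarrow> 'b::euclidean_space"
  assumes "f \<in> borel_measurable F" "integrable M g" "\<And>\<omega>. \<omega> \<in> space M \<Longrightarrow> (norm (f \<omega>))\<^sup>2 \<le> g \<omega>"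
  shows "in_L2 M F f"
  unfolding in_L2_def
proof
  have "f \<in> borel_measurable M"
    by (rule measurable_F_M) fact
  then show "integrable M (\<lambda>\<omega>. (norm (f \<omega>))\<^sup>2)"
    by (intro Bochner_Integration.integrable_bound[OF assms(2)]) 
       (auto intro!: AE_I2 order_trans[OF assms(3)])
qed fact

lemma in_L2_const: "in_L2 M F (\<lambda>_. c)"
  by (simp add: in_L2_def)

text \<open>One argument serves matrices, scalar multiples and coordinate projections alike: the
  squared norm grows at most by the factor \<open>K\<^sup>2\<close>.\<close>

lemma in_L2_bounded_linear:
  fixes f :: "'a \<Rightarrow> 'b::euclidean_space" and T :: "'b \<Rightarrow> 'c::euclidean_space"
  assumes T: "bounded_linear T" and f: "in_L2 M F f"
  shows "in_L2 M F (\<lambda>\<omega>. T (f \<omega>))"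
proof -
  obtain K where K: "\<And>v. norm (T v) \<le> norm v * K"
    using bounded_linear.bounded[OF T] by blast
  show ?thesis
  proof (rule in_L2_I)
    show "(\<lambda>\<omega>. T (f \<omega>)) \<in> borel_measurable F"
      by (rule borel_measurable_continuous_on[OF linear_continuous_on[OF T]])
        (rule in_L2_measurable[OF f])
    show "integrable M (\<lambda>\<omega>. (norm (f \<omega>))\<^sup>2 * K\<^sup>2)"
      using f by (simp add: in_L2_def)
    show "(norm (T (f \<omega>)))\<^sup>2 \<le> (norm (f \<omega>))\<^sup>2 * K\<^sup>2" for \<omega>
      using power_mono[OF K[of "f \<omega>"], of 2] by (simp add: power_mult_distrib)
  qed
qed

lemmas in_L2_matrix = in_L2_bounded_linear[OF matrix_vector_mul_bounded_linear]
lemmas in_L2_scaleR = in_L2_bounded_linear[OF bounded_linear_scaleR_right]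

lemma in_L2_add:
  fixes f g :: "'a \<Rightarrow> 'b::euclidean_space"
  assumes f: "in_L2 M F f" and g: "in_L2 M F g"
  shows "in_L2 M F (\<lambda>\<omega>. f \<omega> + g \<omega>)"
proof (rule in_L2_I)
  show "(\<lambda>\<omega>. f \<omega> + g \<omega>) \<in> borel_measurable F"
    using f g by (intro borel_measurable_add in_L2_measurable)
  show "integrable M (\<lambda>\<omega>. 2 * (norm (f \<omega>))\<^sup>2 + 2 * (norm (g \<omega>))\<^sup>2)"
    using f g by (simp add: in_L2_def)
  fix \<omega>
  have "(norm (f \<omega> + g \<omega>))\<^sup>2 \<le> (norm (f \<omega>) + norm (g \<omega>))\<^sup>2"
    by (intro power_mono norm_triangle_ineq) auto
  also have "\<dots> \<le> 2 * (norm (f \<omega>))\<^sup>2 + 2 * (norm (g \<omega>))\<^sup>2"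
    using sum_squares_bound[of "norm (f \<omega>)" "norm (g \<omega>)"] by (simp add: power2_sum)
  finally show "(norm (f \<omega> + g \<omega>))\<^sup>2 \<le> 2 * (norm (f \<omega>))\<^sup>2 + 2 * (norm (g \<omega>))\<^sup>2" .
qed

lemma in_L2_sum:
  fixes f :: "'i \<Rightarrow> 'a \<Rightarrow> 'b::euclidean_space"
  assumes "\<And>i. i \<in> I \<Longrightarrow> in_L2 M F (f i)"
  shows "in_L2 M F (\<lambda>\<omega>. \<Sum>i\<in>I. f i \<omega>)"
  using assms by (induction I rule: infinite_finite_induct) (auto simp: in_L2_const intro: in_L2_add)

lemma integrable_inner_L2:
  fixes f g :: "'a \<Rightarrow> 'b::euclidean_space"
  assumes f: "in_L2 M F f" and g: "in_L2 M F g"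
  shows "integrable M (\<lambda>\<omega>. f \<omega> \<bullet> g \<omega>)"
proof (rule Bochner_Integration.integrable_bound)
  show "integrable M (\<lambda>\<omega>. (norm (f \<omega>))\<^sup>2 + (norm (g \<omega>))\<^sup>2)"
    using f g by (simp add: in_L2_def)
  show "(\<lambda>\<omega>. f \<omega> \<bullet> g \<omega>) \<in> borel_measurable M"
    using f g by (intro borel_measurable_inner measurable_F_M in_L2_measurable)
  show "AE \<omega> in M. norm (f \<omega> \<bullet> g \<omega>) \<le> norm ((norm (f \<omega>))\<^sup>2 + (norm (g \<omega>))\<^sup>2)"
  proof (rule AE_I2)
    fix \<omega>
    have "norm (f \<omega> \<bullet> g \<omega>) \<le> norm (f \<omega>) * norm (g \<omega>)"
      by (simp add: Cauchy_Schwarz_ineq2)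
    also have "\<dots> \<le> (norm (f \<omega>))\<^sup>2 + (norm (g \<omega>))\<^sup>2"
      using sum_squares_bound[of "norm (f \<omega>)" "norm (g \<omega>)"]
        mult_nonneg_nonneg[OF norm_ge_zero norm_ge_zero, of "f \<omega>" "g \<omega>"] by linarith
    finally show "norm (f \<omega> \<bullet> g \<omega>) \<le> norm ((norm (f \<omega>))\<^sup>2 + (norm (g \<omega>))\<^sup>2)"
      by simp
  qed
qed

text \<open>Each coordinate is an inner product with a constant unit vector, and constants are
  square-integrable because the measure is finite.\<close>

lemma in_L2_integrable:
  fixes f :: "'a \<Rightarrow> real^'n"
  assumes "in_L2 M F f"
  shows "integrable M f"
proof (rule integrable_vec)
  fix i
  show "integrable M (\<lambda>\<omega>. f \<omega> $ i)"
    using integrable_inner_L2[OF assms in_L2_const, of "axis i 1"] by (simp add: inner_axis)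
qed

end

section \<open>Moments of a centred noise independent of the past\<close>

locale independent_noise = L2_space M F for M F :: "'a measure" +
  fixes d :: "'a \<Rightarrow> real^'n"
  assumes d_rv [measurable]: "d \<in> borel_measurable M"
    and moment4: "integrable M (\<lambda>\<omega>. (norm (d \<omega>)) ^ 4)"
    and centred: "(\<integral>\<omega>. d \<omega> \<partial>M) = 0"
    and indep: "\<And>(X :: 'a \<Rightarrow> real) g. X \<in> borel_measurable F \<Longrightarrow> g \<in> borel_measurable borel \<Longrightarrow>
      indep_var borel X borel (\<lambda>\<omega>. g (d \<omega>))"
begin

text \<open>On a probability space the fourth moment controls all lower ones, because r^m \<le> 1 +
  r^4 for r \<ge> 0 and m \<le> 4. Integrability of every polynomial in the noise alone is reduced
  to this bound.\<close>

lemma integrable_noise_bound: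
  assumes "g \<in> borel_measurable borel" and "m \<le> 4" and "\<And>v. \<bar>g v\<bar> \<le> c * norm v ^ m"
  shows "integrable M (\<lambda>\<omega>. g (d \<omega>))"
proof (rule Bochner_Integration.integrable_bound)
  \<comment> \<open>The absolute value of \<open>c\<close> makes the bound monotone in the power of
    the norm without first determining the sign of \<open>c\<close>.\<close>
  show "integrable M (\<lambda>\<omega>. \<bar>c\<bar> * (1 + norm (d \<omega>) ^ 4))"
    using moment4 by simp
  show "(\<lambda>\<omega>. g (d \<omega>)) \<in> borel_measurable M"
    using assms(1) by measurable
  show "AE \<omega> in M. norm (g (d \<omega>)) \<le> norm (\<bar>c\<bar> * (1 + norm (d \<omega>) ^ 4))"
  proof (rule AE_I2)
    fix \<omega>
    have "norm (d \<omega>) ^ m \<le> 1 + norm (d \<omega>) ^ 4"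
    proof (cases "norm (d \<omega>) \<le> 1")
      case True
      have "norm (d \<omega>) ^ m \<le> 1"
        by (rule power_le_one[OF norm_ge_zero True])
      then show ?thesis
        by (rule order_trans) simp
    next
      case False
      have "norm (d \<omega>) ^ m \<le> norm (d \<omega>) ^ 4"
        using False assms(2) by (intro power_increasing) auto
      then show ?thesis
        by simp
    qed
    then have "\<bar>c\<bar> * norm (d \<omega>) ^ m \<le> \<bar>c\<bar> * (1 + norm (d \<omega>) ^ 4)"
      by (intro mult_left_mono) auto
    moreover have "c * norm (d \<omega>) ^ m \<le> \<bar>c\<bar> * norm (d \<omega>) ^ m"
      by (intro mult_right_mono) auto
    ultimately show "norm (g (d \<omega>)) \<le> norm (\<bar>c\<bar> * (1 + norm (d \<omega>) ^ 4))"
      using assms(3)[of "d \<omega>"] by (simp add: abs_mult)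
  qed
qed

text \<open>Independence makes the expectation of a product factorize and carries integrability from
  the factors to the product. Vector expressions are treated by expanding them into coordinates, so
  that every summand is a past factor times a noise factor.\<close>

lemma
  assumes "X \<in> borel_measurable F" "integrable M X"
    and "g \<in> borel_measurable borel" "integrable M (\<lambda>\<omega>. g (d \<omega>))"
  shows integrable_mult_noise: "integrable M (\<lambda>\<omega>. X \<omega> * g (d \<omega>) :: real)"
    and integral_mult_noise:
      "(\<integral>\<omega>. X \<omega> * g (d \<omega>) \<partial>M) = (\<integral>\<omega>. X \<omega> \<partial>M) * (\<integral>\<omega>. g (d \<omega>) \<partial>M)"
proof -
  note * = indep[OF assms(1,3)]
  show "integrable M (\<lambda>\<omega>. X \<omega> * g (d \<omega>))"
    "(\<integral>\<omega>. X \<omega> * g (d \<omega>) \<partial>M) = (\<integral>\<omega>. X \<omega> \<partial>M) * (\<integral>\<omega>. g (d \<omega>) \<partial>M)"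
    using indep_var_integrable[OF * assms(2,4)] indep_var_lebesgue_integral[OF * assms(2,4)]
    by auto
qed

lemma noise_comp_integrable: "integrable M (\<lambda>\<omega>. d \<omega> $ i)"
  by (rule integrable_noise_bound[where m = 1 and c = 1]) (auto simp: component_le_norm_cart)

lemma noise_integrable: "integrable M d"
  by (rule integrable_vec) (rule noise_comp_integrable)

lemma noise_comp2_integrable: "integrable M (\<lambda>\<omega>. d \<omega> $ i * d \<omega> $ j)"
proof (rule integrable_noise_bound[where m = 2 and c = 1])
  show "\<bar>v $ i * v $ j\<bar> \<le> 1 * (norm v)\<^sup>2" for v :: "real^'n"
    by (simp add: abs_mult power2_eq_square mult_mono component_le_norm_cart)
qed auto

text \<open>This and \<open>third\<close> are the statistics \<Sigma> and \<gamma> for the abstract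
  noise \<open>d\<close>. The main proof identifies them with \<open>noise_cov\<close> and
  \<open>noise_gamma\<close>, which are taken at the first disturbance.\<close>

definition cov :: "real^'n^'n" where "cov = (\<integral>\<omega>. outer (d \<omega>) (d \<omega>) \<partial>M)"

definition third :: "real^'n^'n \<Rightarrow> real^'n" where
  "third P = (\<integral>\<omega>. outer (d \<omega>) (d \<omega>) *v (P *v d \<omega>) \<partial>M)"

lemma cov_nth: "cov $ i $ j = (\<integral>\<omega>. d \<omega> $ i * d \<omega> $ j \<partial>M)"
proof -
  have 1: "integrable M (\<lambda>\<omega>. outer (d \<omega>) (d \<omega>) $ i $ j)" for i j
    using noise_comp2_integrable by (simp add: outer_def)
  \<comment> \<open>A matrix is a vector of rows, so the integral passes through the two indices in
    two stages, each with its own integrability condition.\<close>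
  have 2: "integrable M (\<lambda>\<omega>. outer (d \<omega>) (d \<omega>) $ i)" for i
    by (rule integrable_vec) (rule 1)
  show ?thesis
    unfolding cov_def
    by (simp add: integral_vec_nth[OF integrable_vec[OF 2]] integral_vec_nth[OF 2])
       (simp add: outer_def)
qed

text \<open>Cauchy-Schwarz together with the operator bound of \<open>P\<close>. In
  \<open>integrable_noise_bound\<close> the quadratic form, its product with a coordinate and its
  square then count as terms of degree 2, 3 and 4.\<close>

lemma quad_bound: "\<exists>K. \<forall>v. \<bar>v \<bullet> (P *v v)\<bar> \<le> K * (norm v)\<^sup>2" for P :: "real^'n^'n"
proof -
  obtain K where K: "\<And>v. norm (P *v v) \<le> norm v * K"
    using bounded_linear.bounded[OF matrix_vector_mul_bounded_linear[of P]] by blast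
  have "\<bar>v \<bullet> (P *v v)\<bar> \<le> K * (norm v)\<^sup>2" for v
  proof -
    have "\<bar>v \<bullet> (P *v v)\<bar> \<le> norm v * norm (P *v v)"
      by (rule Cauchy_Schwarz_ineq2)
    also have "\<dots> \<le> norm v * (norm v * K)"
      by (intro mult_left_mono K) auto
    finally show ?thesis
      by (simp add: power2_eq_square mult_ac)
  qed
  then show ?thesis by blast
qed

lemma noise_quad_integrable: "integrable M (\<lambda>\<omega>. d \<omega> \<bullet> (P *v d \<omega>))"
proof -
  obtain K where "\<And>v. \<bar>v \<bullet> (P *v v)\<bar> \<le> K * (norm v)\<^sup>2"
    using quad_bound by blast
  then show ?thesis
    by (intro integrable_noise_bound[where m = 2]) auto
qed

lemma noise_quad_square_integrable: "integrable M (\<lambda>\<omega>. (d \<omega> \<bullet> (P *v d \<omega>))\<^sup>2)"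
proof -
  obtain K where K: "\<And>v. \<bar>v \<bullet> (P *v v)\<bar> \<le> K * (norm v)\<^sup>2"
    using quad_bound by blast
  show ?thesis
  proof (rule integrable_noise_bound[where m = 4 and c = "K\<^sup>2"])
    show "\<bar>(v \<bullet> (P *v v))\<^sup>2\<bar> \<le> K\<^sup>2 * norm v ^ 4" for v
      using power_mono[OF K[of v], of 2] by (simp add: power_mult_distrib flip: power_mult)
  qed auto
qed

lemma noise_quad_comp_integrable: "integrable M (\<lambda>\<omega>. d \<omega> $ i * (d \<omega> \<bullet> (P *v d \<omega>)))"
proof -
  obtain K where K: "\<And>v. \<bar>v \<bullet> (P *v v)\<bar> \<le> K * (norm v)\<^sup>2"
    using quad_bound by blast
  show ?thesis
  proof (rule integrable_noise_bound[where m = 3 and c = K])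
    fix v :: "real^'n"
    have "\<bar>v $ i\<bar> * \<bar>v \<bullet> (P *v v)\<bar> \<le> norm v * (K * (norm v)\<^sup>2)"
      by (intro mult_mono K component_le_norm_cart) auto
    then show "\<bar>v $ i * (v \<bullet> (P *v v))\<bar> \<le> K * norm v ^ 3"
      by (simp add: abs_mult power2_eq_square power3_eq_cube mult_ac)
  qed auto
qed

text \<open>The rank-one matrix \<open>outer d d\<close> applied to \<open>P *v d\<close> is the
  multiple of \<open>d\<close> by the scalar \<open>d \<bullet> (P *v d)\<close>.\<close>

lemma third_nth: "third P $ i = (\<integral>\<omega>. d \<omega> $ i * (d \<omega> \<bullet> (P *v d \<omega>)) \<partial>M)"
proof -
  have "integrable M (\<lambda>\<omega>. (d \<omega> \<bullet> (P *v d \<omega>)) *\<^sub>R d \<omega>)"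
    by (rule integrable_vec) (use noise_quad_comp_integrable in \<open>simp add: mult.commute\<close>)
  then show ?thesis
    by (simp add: third_def outer_matrix_vector_mult integral_vec_nth mult.commute)
qed

text \<open>In each coordinate the expectation factorizes and the noise factor has mean zero. Plain
  integrability of \<open>a\<close> suffices, which lets the lemma be applied to a coefficient
  multiplied by an indicator.\<close>

lemma
  assumes "a \<in> borel_measurable F" "integrable M a"
  shows integrable_linear_noise: "integrable M (\<lambda>\<omega>. a \<omega> \<bullet> d \<omega>)"
    and integral_linear_noise: "(\<integral>\<omega>. a \<omega> \<bullet> d \<omega> \<partial>M) = 0"
proof -
  note * = borel_measurable_vec_nth[OF assms(1)] integrable_vec_nth[OF assms(2)]
  have 1: "integrable M (\<lambda>\<omega>. a \<omega> $ i * d \<omega> $ i)" for i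
    by (rule integrable_mult_noise[OF *]) (auto intro: noise_comp_integrable)
  have 2: "(\<integral>\<omega>. a \<omega> $ i * d \<omega> $ i \<partial>M) = 0" for i
  proof -
    have "(\<integral>\<omega>. a \<omega> $ i * d \<omega> $ i \<partial>M) = (\<integral>\<omega>. a \<omega> $ i \<partial>M) * (\<integral>\<omega>. d \<omega> $ i \<partial>M)"
      by (rule integral_mult_noise[OF *]) (auto intro: noise_comp_integrable)
    then show ?thesis
      using integral_vec_nth[OF noise_integrable, of i] centred by simp
  qed
  show "integrable M (\<lambda>\<omega>. a \<omega> \<bullet> d \<omega>)" "(\<integral>\<omega>. a \<omega> \<bullet> d \<omega> \<partial>M) = 0"
    using 1 2 by (simp_all add: inner_vec_def)
qed

text \<open>In coordinates the past factors are \<open>a $ i * b $ j\<close>, integrable since both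
  vectors are square-integrable, and the noise factors \<open>d $ i * d $ j\<close> have the entries
  of \<open>cov\<close> as means.\<close>

lemma
  assumes a: "in_L2 M F a" and b: "in_L2 M F b"
  shows integrable_linear_noise_mult: "integrable M (\<lambda>\<omega>. (a \<omega> \<bullet> d \<omega>) * (b \<omega> \<bullet> d \<omega>))"
    and integral_linear_noise_mult:
      "(\<integral>\<omega>. (a \<omega> \<bullet> d \<omega>) * (b \<omega> \<bullet> d \<omega>) \<partial>M) = (\<integral>\<omega>. a \<omega> \<bullet> (cov *v b \<omega>) \<partial>M)"
proof -
  have m: "(\<lambda>\<omega>. a \<omega> $ i * b \<omega> $ j) \<in> borel_measurable F" for i j
    using a b by (intro borel_measurable_times borel_measurable_vec_nth in_L2_measurable)
  have i: "integrable M (\<lambda>\<omega>. a \<omega> $ i * b \<omega> $ j)" for i j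
    using integrable_inner_L2[OF in_L2_bounded_linear[OF bounded_linear_vec_nth a]
        in_L2_bounded_linear[OF bounded_linear_vec_nth b]] by simp
  have eq: "(a \<omega> \<bullet> d \<omega>) * (b \<omega> \<bullet> d \<omega>) =
      (\<Sum>i\<in>UNIV. \<Sum>j\<in>UNIV. (a \<omega> $ i * b \<omega> $ j) * (d \<omega> $ i * d \<omega> $ j))" for \<omega>
    by (simp add: inner_vec_def sum_product mult_ac)
  have 1: "integrable M (\<lambda>\<omega>. (a \<omega> $ i * b \<omega> $ j) * (d \<omega> $ i * d \<omega> $ j))" for i j
    by (rule integrable_mult_noise[OF m i]) (auto intro: noise_comp2_integrable)
  have 2: "(\<integral>\<omega>. (a \<omega> $ i * b \<omega> $ j) * (d \<omega> $ i * d \<omega> $ j) \<partial>M) =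
      (\<integral>\<omega>. a \<omega> $ i * cov $ i $ j * b \<omega> $ j \<partial>M)" for i j
  proof -
    have "(\<integral>\<omega>. (a \<omega> $ i * b \<omega> $ j) * (d \<omega> $ i * d \<omega> $ j) \<partial>M) =
        (\<integral>\<omega>. a \<omega> $ i * b \<omega> $ j \<partial>M) * cov $ i $ j"
      unfolding cov_nth
      by (rule integral_mult_noise[OF m i]) (auto intro: noise_comp2_integrable)
    also have "\<dots> = (\<integral>\<omega>. (a \<omega> $ i * b \<omega> $ j) * cov $ i $ j \<partial>M)"
      by simp
    finally show ?thesis
      by (simp add: mult_ac)
  qed
  have 3: "integrable M (\<lambda>\<omega>. a \<omega> $ i * cov $ i $ j * b \<omega> $ j)" for i j
    using integrable_mult_right[OF i, of "cov $ i $ j"] by (simp add: mult_ac)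
  show "integrable M (\<lambda>\<omega>. (a \<omega> \<bullet> d \<omega>) * (b \<omega> \<bullet> d \<omega>))"
    unfolding eq by (intro Bochner_Integration.integrable_sum 1)
  show "(\<integral>\<omega>. (a \<omega> \<bullet> d \<omega>) * (b \<omega> \<bullet> d \<omega>) \<partial>M) = (\<integral>\<omega>. a \<omega> \<bullet> (cov *v b \<omega>) \<partial>M)"
    unfolding eq inner_matrix_vector_sum by (simp add: 1 2 3)
qed

text \<open>All noise factors form a single cubic term per coordinate, so the past enters only
  through the mean of \<open>a\<close>.\<close>

lemma
  assumes a: "in_L2 M F a"
  shows integrable_linear_quad_noise: "integrable M (\<lambda>\<omega>. (a \<omega> \<bullet> d \<omega>) * (d \<omega> \<bullet> (P *v d \<omega>)))"
    and integral_linear_quad_noise: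
      "(\<integral>\<omega>. (a \<omega> \<bullet> d \<omega>) * (d \<omega> \<bullet> (P *v d \<omega>)) \<partial>M) = (\<integral>\<omega>. a \<omega> \<partial>M) \<bullet> third P"
proof -
  have int: "integrable M a"
    by (rule in_L2_integrable[OF a])
  note * = borel_measurable_vec_nth[OF in_L2_measurable[OF a]] integrable_vec_nth[OF int]
  have eq: "(a \<omega> \<bullet> d \<omega>) * (d \<omega> \<bullet> (P *v d \<omega>)) =
      (\<Sum>i\<in>UNIV. a \<omega> $ i * (d \<omega> $ i * (d \<omega> \<bullet> (P *v d \<omega>))))" for \<omega>
    by (simp add: inner_vec_def[of "a \<omega>"] sum_distrib_right mult.assoc)
  have 1: "integrable M (\<lambda>\<omega>. a \<omega> $ i * (d \<omega> $ i * (d \<omega> \<bullet> (P *v d \<omega>))))" for i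
    by (rule integrable_mult_noise[OF *]) (auto intro: noise_quad_comp_integrable)
  have 2: "(\<integral>\<omega>. a \<omega> $ i * (d \<omega> $ i * (d \<omega> \<bullet> (P *v d \<omega>))) \<partial>M) =
      (\<integral>\<omega>. a \<omega> \<partial>M) $ i * third P $ i" for i
    unfolding third_nth integral_vec_nth[OF int]
    by (rule integral_mult_noise[OF *]) (auto intro: noise_quad_comp_integrable)
  show "integrable M (\<lambda>\<omega>. (a \<omega> \<bullet> d \<omega>) * (d \<omega> \<bullet> (P *v d \<omega>)))"
    unfolding eq by (intro Bochner_Integration.integrable_sum 1)
  show "(\<integral>\<omega>. (a \<omega> \<bullet> d \<omega>) * (d \<omega> \<bullet> (P *v d \<omega>)) \<partial>M) = (\<integral>\<omega>. a \<omega> \<partial>M) \<bullet> third P"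
    unfolding eq by (simp add: 1 2 inner_vec_def[of _ "third P"])
qed

definition quad_mean :: "real^'n^'n \<Rightarrow> real" where
  "quad_mean P = (\<integral>\<omega>. d \<omega> \<bullet> (P *v d \<omega>) \<partial>M)"

lemma quad_mean_eq_trace: "quad_mean P = trace (P ** cov)"
proof -
  \<comment> \<open>The noise factors are ordered so that their mean is \<open>cov $ j $ i\<close>,
    the entry that the diagonal of \<open>P ** cov\<close> pairs with
    \<open>P $ i $ j\<close>.\<close>
  have eq: "v \<bullet> (P *v v) = (\<Sum>i\<in>UNIV. \<Sum>j\<in>UNIV. P $ i $ j * (v $ j * v $ i))" for v
    unfolding inner_matrix_vector_sum by (simp add: mult_ac)
  have "quad_mean P = (\<Sum>i\<in>UNIV. \<Sum>j\<in>UNIV. \<integral>\<omega>. P $ i $ j * (d \<omega> $ j * d \<omega> $ i) \<partial>M)"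
    unfolding quad_mean_def eq by (simp add: noise_comp2_integrable)
  also have "\<dots> = trace (P ** cov)"
    by (simp add: trace_def matrix_matrix_mult_def cov_nth)
  finally show ?thesis .
qed

text \<open>The conditional expectation is \<open>f + quad_mean P\<close>, as integration over sets
  S of \<open>F\<close> shows: the indicator of S times \<open>r\<close> is again a past
  coefficient, so the linear term vanishes, and the indicator is independent of the quadratic term.
  The formula for \<open>z\<close> is asked for on \<open>space M\<close> only, which is where the
  dynamics are given.\<close>

lemma real_cond_exp_affine_quad_noise:
  assumes f: "f \<in> borel_measurable F" "integrable M f"
    and r: "r \<in> borel_measurable F" "integrable M r"
    and z: "\<And>\<omega>. \<omega> \<in> space M \<Longrightarrow> z \<omega> = f \<omega> + r \<omega> \<bullet> d \<omega> + d \<omega> \<bullet> (P *v d \<omega>)"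
  shows "AE \<omega> in M. z \<omega> - real_cond_exp M F z \<omega> = r \<omega> \<bullet> d \<omega> + d \<omega> \<bullet> (P *v d \<omega>) - quad_mean P"
proof -
  let ?q = "\<lambda>\<omega>. d \<omega> \<bullet> (P *v d \<omega>)"
  have int: "integrable M z"
    using f(2) integrable_linear_noise[OF r] noise_quad_integrable[of P]
    by (subst Bochner_Integration.integrable_cong[OF refl z]) auto
  have "AE \<omega> in M. real_cond_exp M F z \<omega> = f \<omega> + quad_mean P"
  proof (rule real_cond_exp_charact)
    fix S assume S: "S \<in> sets F"
    then have SM: "S \<in> sets M"
      using subalg by (auto simp: subalgebra_def)
    have rS: "(\<lambda>\<omega>. indicator S \<omega> *\<^sub>R r \<omega>) \<in> borel_measurable F"
      "integrable M (\<lambda>\<omega>. indicator S \<omega> *\<^sub>R r \<omega>)"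
      using S r SM by (auto intro!: integrable_mult_indicator)
    have iS: "(indicator S :: 'a \<Rightarrow> real) \<in> borel_measurable F" "integrable M (indicator S :: 'a \<Rightarrow> real)"
      using S SM by (auto simp: emeasure_eq_measure)
    have fS: "integrable M (\<lambda>\<omega>. indicator S \<omega> * f \<omega>)"
      using integrable_mult_indicator[OF SM f(2)] by simp
    have 1: "integrable M (\<lambda>\<omega>. indicator S \<omega> * (r \<omega> \<bullet> d \<omega>))"
      "(\<integral>\<omega>. indicator S \<omega> * (r \<omega> \<bullet> d \<omega>) \<partial>M) = 0"
      using integrable_linear_noise[OF rS] integral_linear_noise[OF rS] by simp_all
    have 2: "integrable M (\<lambda>\<omega>. indicator S \<omega> * ?q \<omega>)"
      by (rule integrable_mult_noise[OF iS]) (auto intro: noise_quad_integrable)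
    have 3: "(\<integral>\<omega>. indicator S \<omega> * ?q \<omega> \<partial>M) = (\<integral>\<omega>. indicator S \<omega> \<partial>M) * quad_mean P"
      unfolding quad_mean_def
      by (rule integral_mult_noise[OF iS]) (auto intro: noise_quad_integrable)
    have "(\<integral>\<omega>\<in>S. z \<omega> \<partial>M) =
        (\<integral>\<omega>. indicator S \<omega> * f \<omega> + indicator S \<omega> * (r \<omega> \<bullet> d \<omega>) + indicator S \<omega> * ?q \<omega> \<partial>M)"
      unfolding set_lebesgue_integral_def
      by (rule Bochner_Integration.integral_cong) (auto simp: z algebra_simps)
    also have "\<dots> = (\<integral>\<omega>. indicator S \<omega> * f \<omega> + indicator S \<omega> * quad_mean P \<partial>M)"
      using fS 1 2 3 iS by simp
    also have "\<dots> = (\<integral>\<omega>\<in>S. f \<omega> + quad_mean P \<partial>M)"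
      unfolding set_lebesgue_integral_def by (simp add: algebra_simps)
    finally show "(\<integral>\<omega>\<in>S. z \<omega> \<partial>M) = (\<integral>\<omega>\<in>S. f \<omega> + quad_mean P \<partial>M)" .
  qed (use f int in auto)
  with AE_space show ?thesis
    by eventually_elim (simp add: z)
qed

end

section \<open>Second moments of the innovations, expressed through the state
  \<open>v + d\<close>\<close>

lemma inner_matrix_vector_mult:
  fixes P :: "real^'n^'m"
  shows "v \<bullet> (P *v z) = (transpose P *v v) \<bullet> z"
  by (simp only: transpose_matrix_vector dot_lmul_matrix)

context independent_noise
begin

text \<open>The purely quadratic part of an innovation. It has mean zero, so its mean square is the
  variance of the quadratic form.\<close>

abbreviation cquad :: "real^'n^'n \<Rightarrow> 'a \<Rightarrow> real" where
  "cquad P \<omega> \<equiv> d \<omega> \<bullet> (P *v d \<omega>) - quad_mean P"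

text \<open>The two cross terms combine to \<open>((R + transpose R) *v v) \<bullet> d\<close>,
  which has mean zero; the trace is the mean of the quadratic form in the noise.\<close>

lemma
  assumes v: "in_L2 M F v"
  shows integrable_quad_affine_noise:
      "integrable M (\<lambda>\<omega>. (v \<omega> + d \<omega>) \<bullet> (R *v (v \<omega> + d \<omega>)))"
    and integral_quad_affine_noise:
      "(\<integral>\<omega>. (v \<omega> + d \<omega>) \<bullet> (R *v (v \<omega> + d \<omega>)) \<partial>M) =
        (\<integral>\<omega>. v \<omega> \<bullet> (R *v v \<omega>) \<partial>M) + trace (R ** cov)"
proof -
  have eq: "(v \<omega> + d \<omega>) \<bullet> (R *v (v \<omega> + d \<omega>)) =
      v \<omega> \<bullet> (R *v v \<omega>) + ((R + transpose R) *v v \<omega>) \<bullet> d \<omega> + d \<omega> \<bullet> (R *v d \<omega>)" for \<omega>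
    by (simp add: matrix_vector_right_distrib matrix_vector_mult_add_rdistrib inner_add_left
        inner_add_right inner_matrix_vector_mult[of "v \<omega>" R "d \<omega>"] inner_commute[of "d \<omega>" "R *v v \<omega>"])
  have Rv: "in_L2 M F (\<lambda>\<omega>. (R + transpose R) *v v \<omega>)"
    by (rule in_L2_matrix[OF v])
  note lin = in_L2_measurable[OF Rv] in_L2_integrable[OF Rv]
  note int = integrable_inner_L2[OF v in_L2_matrix[OF v, of R]] integrable_linear_noise[OF lin]
    noise_quad_integrable[of R]
  show "integrable M (\<lambda>\<omega>. (v \<omega> + d \<omega>) \<bullet> (R *v (v \<omega> + d \<omega>)))"
    unfolding eq by (intro Bochner_Integration.integrable_add int)
  show "(\<integral>\<omega>. (v \<omega> + d \<omega>) \<bullet> (R *v (v \<omega> + d \<omega>)) \<partial>M) =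
        (\<integral>\<omega>. v \<omega> \<bullet> (R *v v \<omega>) \<partial>M) + trace (R ** cov)"
    unfolding eq quad_mean_eq_trace[symmetric] quad_mean_def
    using int integral_linear_noise[OF lin] by simp
qed

lemma
  assumes v: "in_L2 M F v"
  shows integrable_inner_affine_noise: "integrable M (\<lambda>\<omega>. (v \<omega> + d \<omega>) \<bullet> c)"
    and integral_inner_affine_noise:
      "(\<integral>\<omega>. (v \<omega> + d \<omega>) \<bullet> c \<partial>M) = (\<integral>\<omega>. v \<omega> \<partial>M) \<bullet> c"
  using in_L2_integrable[OF v] noise_integrable centred by simp_all

text \<open>Centring the quadratic form changes nothing in the expectation, because the constant is
  multiplied by the mean of \<open>a \<bullet> d\<close>, which is zero.\<close>

lemma
  assumes a: "in_L2 M F a"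
  shows integrable_linear_cquad_noise: "integrable M (\<lambda>\<omega>. (a \<omega> \<bullet> d \<omega>) * cquad P \<omega>)"
    and integral_linear_cquad_noise:
      "(\<integral>\<omega>. (a \<omega> \<bullet> d \<omega>) * cquad P \<omega> \<partial>M) = (\<integral>\<omega>. a \<omega> \<partial>M) \<bullet> third P"
proof -
  note lin = in_L2_measurable[OF a] in_L2_integrable[OF a]
  note int = integrable_linear_quad_noise[OF a, of P] integrable_linear_noise[OF lin]
  show "integrable M (\<lambda>\<omega>. (a \<omega> \<bullet> d \<omega>) * cquad P \<omega>)"
    "(\<integral>\<omega>. (a \<omega> \<bullet> d \<omega>) * cquad P \<omega> \<partial>M) = (\<integral>\<omega>. a \<omega> \<partial>M) \<bullet> third P"
    using int integral_linear_noise[OF lin] integral_linear_quad_noise[OF a, of P]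
    by (simp_all add: right_diff_distrib)
qed

lemma integrable_cquad_square: "integrable M (\<lambda>\<omega>. (cquad P \<omega>)\<^sup>2)"
  by (simp add: power2_diff noise_quad_square_integrable noise_quad_integrable)

text \<open>The square is expanded with \<open>a = P *v v\<close>; its terms produce a quadratic
  form in \<open>cov\<close>, the third moment and the variance. Passing from \<open>v\<close> to
  \<open>x\<close> raises the quadratic part by \<open>trace (P ** cov ** P ** cov)\<close> and
  leaves the linear part unchanged, so four times this trace is subtracted.\<close>

lemma
  assumes P: "transpose P = P" and v: "in_L2 M F v"
  defines "y \<equiv> \<lambda>\<omega>. 2 * ((P *v v \<omega>) \<bullet> d \<omega>) + cquad P \<omega>"
    and "x \<equiv> \<lambda>\<omega>. v \<omega> + d \<omega>"
  shows integrable_innovation_square: "integrable M (\<lambda>\<omega>. (y \<omega>)\<^sup>2)"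
    and integral_innovation_square: "(\<integral>\<omega>. (y \<omega>)\<^sup>2 \<partial>M) =
      4 * (\<integral>\<omega>. x \<omega> \<bullet> ((P ** cov ** P) *v x \<omega>) + x \<omega> \<bullet> (P *v third P) \<partial>M)
      + (variance (\<lambda>\<omega>. d \<omega> \<bullet> (P *v d \<omega>)) - 4 * trace ((cov ** P) ** (cov ** P)))"
proof -
  define a where "a \<omega> = P *v v \<omega>" for \<omega>
  have a: "in_L2 M F a"
    unfolding a_def by (rule in_L2_matrix[OF v])
  have eq: "(y \<omega>)\<^sup>2 = 4 * ((a \<omega> \<bullet> d \<omega>) * (a \<omega> \<bullet> d \<omega>)) + 4 * ((a \<omega> \<bullet> d \<omega>) * cquad P \<omega>)
      + (cquad P \<omega>)\<^sup>2" for \<omega>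
    unfolding y_def a_def[symmetric] by (simp add: power2_eq_square algebra_simps)
  note int = integrable_linear_noise_mult[OF a a] integrable_linear_cquad_noise[OF a, of P]
    integrable_cquad_square[of P]
  show "integrable M (\<lambda>\<omega>. (y \<omega>)\<^sup>2)"
    unfolding eq using int by simp
  have "(\<integral>\<omega>. (y \<omega>)\<^sup>2 \<partial>M) = 4 * (\<integral>\<omega>. a \<omega> \<bullet> (cov *v a \<omega>) \<partial>M) + 4 * ((\<integral>\<omega>. a \<omega> \<partial>M) \<bullet> third P)
      + variance (\<lambda>\<omega>. d \<omega> \<bullet> (P *v d \<omega>))"
    unfolding eq using int integral_linear_noise_mult[OF a a] integral_linear_cquad_noise[OF a, of P]
    by (simp add: quad_mean_def)
  moreover have "(\<integral>\<omega>. x \<omega> \<bullet> ((P ** cov ** P) *v x \<omega>) + x \<omega> \<bullet> (P *v third P) \<partial>M) =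
      (\<integral>\<omega>. v \<omega> \<bullet> ((P ** cov ** P) *v v \<omega>) \<partial>M) + trace ((P ** cov ** P) ** cov)
      + (\<integral>\<omega>. v \<omega> \<partial>M) \<bullet> (P *v third P)"
    unfolding x_def integral_quad_affine_noise[OF v, symmetric]
      integral_inner_affine_noise[OF v, symmetric]
    by (rule Bochner_Integration.integral_add integrable_quad_affine_noise
        integrable_inner_affine_noise v)+
  \<comment> \<open>Symmetry of \<open>P\<close> moves the left factor over to the first
    argument.\<close>
  moreover have "v \<omega> \<bullet> ((P ** cov ** P) *v v \<omega>) = a \<omega> \<bullet> (cov *v a \<omega>)" for \<omega>
    using inner_matrix_vector_mult[of "v \<omega>" P "cov *v a \<omega>"] P
    by (simp add: a_def matrix_vector_mul_assoc matrix_mul_assoc)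
  moreover have "(\<integral>\<omega>. v \<omega> \<partial>M) \<bullet> (P *v third P) = (\<integral>\<omega>. a \<omega> \<partial>M) \<bullet> third P"
    using integral_bounded_linear[OF matrix_vector_mul_bounded_linear in_L2_integrable[OF v], of P]
      inner_matrix_vector_mult[of "\<integral>\<omega>. v \<omega> \<partial>M" P] P by (simp add: a_def)
  \<comment> \<open>Cyclic invariance of the trace.\<close>
  moreover have "trace ((P ** cov ** P) ** cov) = trace ((cov ** P) ** (cov ** P))"
    using trace_mul_sym[of "P ** cov ** P" cov] by (simp add: matrix_mul_assoc)
  ultimately show "(\<integral>\<omega>. (y \<omega>)\<^sup>2 \<partial>M) =
      4 * (\<integral>\<omega>. x \<omega> \<bullet> ((P ** cov ** P) *v x \<omega>) + x \<omega> \<bullet> (P *v third P) \<partial>M)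
      + (variance (\<lambda>\<omega>. d \<omega> \<bullet> (P *v d \<omega>)) - 4 * trace ((cov ** P) ** (cov ** P)))"
    by simp
qed

text \<open>Here \<open>v\<close> may be replaced by \<open>x\<close> without correction: the
  additional term is linear in \<open>d\<close> with a coefficient determined by the past, hence has
  mean zero.\<close>

lemma
  assumes P: "transpose P = P" and v: "in_L2 M F v" and s: "in_L2 M F s"
  defines "y \<equiv> \<lambda>\<omega>. 2 * ((P *v v \<omega>) \<bullet> d \<omega>) + cquad P \<omega>"
    and "x \<equiv> \<lambda>\<omega>. v \<omega> + d \<omega>"
  shows integrable_linear_innovation: "integrable M (\<lambda>\<omega>. (s \<omega> \<bullet> d \<omega>) * y \<omega>)"
    and integrable_linear_gamma: "integrable M (\<lambda>\<omega>. s \<omega> \<bullet> (third P + 2 *\<^sub>R ((cov ** P) *v x \<omega>)))"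
    and integral_linear_innovation: "(\<integral>\<omega>. (s \<omega> \<bullet> d \<omega>) * y \<omega> \<partial>M) =
      (\<integral>\<omega>. s \<omega> \<bullet> (third P + 2 *\<^sub>R ((cov ** P) *v x \<omega>)) \<partial>M)"
proof -
  define a where "a \<omega> = P *v v \<omega>" for \<omega>
  have a: "in_L2 M F a"
    unfolding a_def by (rule in_L2_matrix[OF v])
  have eq: "(s \<omega> \<bullet> d \<omega>) * y \<omega> = 2 * ((s \<omega> \<bullet> d \<omega>) * (a \<omega> \<bullet> d \<omega>)) + (s \<omega> \<bullet> d \<omega>) * cquad P \<omega>"
    for \<omega>
    unfolding y_def a_def[symmetric] by (simp add: algebra_simps)
  note int = integrable_linear_noise_mult[OF s a] integrable_linear_cquad_noise[OF s, of P]
  show "integrable M (\<lambda>\<omega>. (s \<omega> \<bullet> d \<omega>) * y \<omega>)"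
    unfolding eq using int by simp
  have 1: "(\<integral>\<omega>. (s \<omega> \<bullet> d \<omega>) * y \<omega> \<partial>M) =
      2 * (\<integral>\<omega>. s \<omega> \<bullet> (cov *v a \<omega>) \<partial>M) + (\<integral>\<omega>. s \<omega> \<partial>M) \<bullet> third P"
    unfolding eq using int integral_linear_noise_mult[OF s a] integral_linear_cquad_noise[OF s, of P]
    by simp
  \<comment> \<open>The coefficient of \<open>d\<close> after the matrix has been moved over to
    \<open>s\<close>.\<close>
  define r where "r \<omega> = transpose (cov ** P) *v s \<omega>" for \<omega>
  have r: "in_L2 M F r"
    unfolding r_def by (rule in_L2_matrix[OF s])
  note lin = in_L2_measurable[OF r] in_L2_integrable[OF r]
  have eq': "s \<omega> \<bullet> (third P + 2 *\<^sub>R ((cov ** P) *v x \<omega>)) =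
      s \<omega> \<bullet> third P + 2 * (s \<omega> \<bullet> (cov *v a \<omega>)) + 2 * (r \<omega> \<bullet> d \<omega>)" for \<omega>
    using inner_matrix_vector_mult[of "s \<omega>" "cov ** P" "d \<omega>"]
    by (simp add: x_def r_def a_def inner_add_right matrix_vector_right_distrib
        matrix_vector_mul_assoc)
  have s3: "integrable M (\<lambda>\<omega>. s \<omega> \<bullet> third P)"
    using in_L2_integrable[OF s] by simp
  note int' = s3 integrable_inner_L2[OF s in_L2_matrix[OF a, of cov]]
    integrable_linear_noise[OF lin]
  show "integrable M (\<lambda>\<omega>. s \<omega> \<bullet> (third P + 2 *\<^sub>R ((cov ** P) *v x \<omega>)))"
    unfolding eq' using int' by simp
  show "(\<integral>\<omega>. (s \<omega> \<bullet> d \<omega>) * y \<omega> \<partial>M) =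
      (\<integral>\<omega>. s \<omega> \<bullet> (third P + 2 *\<^sub>R ((cov ** P) *v x \<omega>)) \<partial>M)"
    unfolding 1 eq' using int' integral_linear_noise[OF lin] in_L2_integrable[OF s] by simp
qed

end

section \<open>Independence of a disturbance from the earlier history\<close>

lemma (in prob_space) indep_var_vimage_algebra:
  assumes indep: "indep_var S X T Y"
    and X': "X' \<in> measurable (vimage_algebra (space M) X S) S'"
    and Y': "Y' \<in> measurable (vimage_algebra (space M) Y T) T'"
  shows "indep_var S' X' T' Y'"
proof -
  have XY: "random_variable S X" "random_variable T Y"
    using indep by (auto dest: indep_var_rv1 indep_var_rv2)
  have sub: "sets (vimage_algebra (space M) X S) \<subseteq> events" "sets (vimage_algebra (space M) Y T) \<subseteq> events"
    by (rule sets_image_in_sets[OF refl], rule XY)+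
  have rv: "random_variable S' X'" "random_variable T' Y'"
    by (rule measurable_from_subalg[OF _ X'] measurable_from_subalg[OF _ Y'],
        use sub in \<open>simp add: subalgebra_def\<close>)+
  \<comment> \<open>Independence is a property of the generated \<sigma>-algebras and is inherited
    by smaller ones. Thus \<open>X'\<close> and \<open>Y'\<close> need not be exhibited as functions
    of \<open>X\<close> and \<open>Y\<close>.\<close>
  have "indep_set (sets (vimage_algebra (space M) X S)) (sets (vimage_algebra (space M) Y T))"
    using indep by (simp add: indep_var_eq sets_vimage_algebra)
  then have "indep_set (sets (vimage_algebra (space M) X' S')) (sets (vimage_algebra (space M) Y' T'))"
    unfolding indep_set_def
    by (rule indep_sets_mono_sets)
       (use sets_image_in_sets[OF space_vimage_algebra X'] sets_image_in_sets[OF space_vimage_algebra Y']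
         in \<open>auto split: bool.splits\<close>)
  then show ?thesis
    using rv by (simp add: indep_var_eq sets_vimage_algebra)
qed

lemma measurable_hist_algebra_state:
  assumes "i \<le> t"
  shows "x i \<in> borel_measurable (hist_algebra M x u t)"
proof -
  let ?h = "\<lambda>\<omega>. (\<lambda>i\<in>{..t}. x i \<omega>, \<lambda>i\<in>{..<t}. u i \<omega>)"
  have h: "?h \<in> measurable (hist_algebra M x u t) ((\<Pi>\<^sub>M i\<in>{..t}. borel) \<Otimes>\<^sub>M (\<Pi>\<^sub>M i\<in>{..<t}. borel))"
    unfolding hist_algebra_def
    by (rule measurable_vimage_algebra1) (auto simp: space_pair_measure space_PiM)
  have "(\<lambda>\<omega>. fst (?h \<omega>) i) \<in> borel_measurable (hist_algebra M x u t)"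
    by (rule measurable_compose[OF measurable_compose[OF h measurable_fst]
          measurable_component_singleton]) (use assms in auto)
  then show ?thesis
    using assms by simp
qed

text \<open>A map into a product is measurable as soon as its coordinates are, and the history
  algebra is the smallest one for which the history map is measurable.\<close>

lemma subalgebra_hist_algebra:
  assumes "space G = space M"
    and "\<And>i. i \<le> t \<Longrightarrow> x i \<in> borel_measurable G" "\<And>i. i < t \<Longrightarrow> u i \<in> borel_measurable G"
  shows "subalgebra G (hist_algebra M x u t)"
  unfolding subalgebra_def
proof
  show "space (hist_algebra M x u t) = space G"
    using assms(1) by (simp add: hist_algebra_def)
  show "sets (hist_algebra M x u t) \<subseteq> sets G"
    unfolding hist_algebra_def using assms
    by (intro sets_image_in_sets measurable_Pair measurable_restrict) auto
qed

text \<open>The history up to time s lies in the \<sigma>-algebra of the initial state and the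
  disturbances before s; the disturbance at time s belongs to a disjoint part of the independent
  family.\<close>

lemma (in prob_space) hist_algebra_indep_disturbance:
  fixes x w :: "nat \<Rightarrow> 'a \<Rightarrow> real^'n" and u :: "nat \<Rightarrow> 'a \<Rightarrow> real^'m"
    and A :: "real^'n^'n" and B :: "real^'m^'n" and X g :: "_ \<Rightarrow> real"
  assumes dyn: "\<And>s \<omega>. s < N \<Longrightarrow> \<omega> \<in> space M \<Longrightarrow> x (Suc s) \<omega> = A *v x s \<omega> + B *v u s \<omega> + w s \<omega>"
    and indep: "indep_vars (\<lambda>_. borel) (\<lambda>i. case i of 0 \<Rightarrow> x 0 | Suc s \<Rightarrow> w s) {..N}"
    and adapted: "\<And>s. s < N \<Longrightarrow> u s \<in> borel_measurable (hist_algebra M x u s)"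
    and s: "s < N"
    and X: "X \<in> borel_measurable (hist_algebra M x u s)"
    and g: "g \<in> borel_measurable borel"
  shows "indep_var borel X borel (\<lambda>\<omega>. g (w s \<omega>))"
proof -
  let ?Y = "\<lambda>i. case i of 0 \<Rightarrow> x 0 | Suc s \<Rightarrow> w s"
  \<comment> \<open>Index 0 carries the initial state and index \<open>Suc r\<close> the disturbance
    \<open>w r\<close>. Hence \<open>G {..s}\<close> ends with the disturbance before time s, and
    \<open>w s\<close> has index \<open>Suc s\<close>.\<close>
  define G where "G I = vimage_algebra (space M) (\<lambda>\<omega>. \<lambda>i\<in>I. ?Y i \<omega>) (\<Pi>\<^sub>M i\<in>I. borel)" for I
  have [simp]: "space (G I) = space M" for I
    by (simp add: G_def)
  have Y: "?Y i \<in> borel_measurable (G I)" if "i \<in> I" for i I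
  proof -
    have "(\<lambda>\<omega>. \<lambda>i\<in>I. ?Y i \<omega>) \<in> measurable (G I) (\<Pi>\<^sub>M i\<in>I. borel)"
      unfolding G_def by (rule measurable_vimage_algebra1) (auto simp: space_PiM)
    from measurable_compose[OF this measurable_component_singleton[OF that]] that
    show ?thesis by simp
  qed
  \<comment> \<open>States are included up to r, controls only before r, exactly as in the history
    at time r. The induction step can then first place \<open>u r\<close>, which is measurable for
    that history, and after it \<open>x (Suc r)\<close>.\<close>
  have "(\<forall>i\<le>r. x i \<in> borel_measurable (G {..s})) \<and> (\<forall>i<r. u i \<in> borel_measurable (G {..s}))"
    if "r \<le> s" for r
    using that
  proof (induction r)
    case 0
    then show ?case
      using Y[of 0 "{..s}"] by simp
  next
    case (Suc r)
    then have IH: "\<And>i. i \<le> r \<Longrightarrow> x i \<in> borel_measurable (G {..s})"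
      "\<And>i. i < r \<Longrightarrow> u i \<in> borel_measurable (G {..s})"
      by auto
    have "subalgebra (G {..s}) (hist_algebra M x u r)"
      using IH by (intro subalgebra_hist_algebra) auto
    then have ur: "u r \<in> borel_measurable (G {..s})"
      by (rule measurable_from_subalg) (use Suc.prems s in \<open>simp add: adapted\<close>)
    have "w r \<in> borel_measurable (G {..s})"
      using Y[of "Suc r" "{..s}"] Suc.prems by simp
    then have "(\<lambda>\<omega>. A *v x r \<omega> + B *v u r \<omega> + w r \<omega>) \<in> borel_measurable (G {..s})"
      using ur IH(1)[of r]
      by (intro borel_measurable_add borel_measurable_matrix_vector_mult) auto
    then have "x (Suc r) \<in> borel_measurable (G {..s})"
      using Suc.prems s dyn by (subst measurable_cong[of "G {..s}"]) auto
    then show ?case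
      using IH ur by (auto simp: le_Suc_eq less_Suc_eq)
  qed
  then have "subalgebra (G {..s}) (hist_algebra M x u s)"
    by (intro subalgebra_hist_algebra) auto
  then have X': "X \<in> borel_measurable (G {..s})"
    using X by (rule measurable_from_subalg)
  have g': "(\<lambda>\<omega>. g (w s \<omega>)) \<in> borel_measurable (G {Suc s})"
    using measurable_compose[OF Y[of "Suc s" "{Suc s}"] g] by simp
  \<comment> \<open>Subfamilies of an independent family over disjoint index sets are
    independent.\<close>
  have "indep_var (\<Pi>\<^sub>M i\<in>{..s}. borel) (\<lambda>\<omega>. \<lambda>i\<in>{..s}. ?Y i \<omega>)
      (\<Pi>\<^sub>M i\<in>{Suc s}. borel) (\<lambda>\<omega>. \<lambda>i\<in>{Suc s}. ?Y i \<omega>)"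
    by (rule indep_var_restrict[OF indep]) (use s in auto)
  from indep_var_vimage_algebra[OF this X'[unfolded G_def] g'[unfolded G_def]] show ?thesis .
qed

section \<open>Block structure of the coupled quadratic form\<close>

lemma quad_form_block_index:
  "quad_form (block_index m) Q (eta x t \<omega>) =
    (\<Sum>i\<le>m. \<Sum>j\<le>m. x (t - i) \<omega> \<bullet> (blk Q i j *v x (t - j) \<omega>))"
proof -
  have "quad_form (block_index m) Q (eta x t \<omega>) =
      (\<Sum>i\<le>m. \<Sum>a\<in>UNIV. \<Sum>j\<le>m. \<Sum>b\<in>UNIV. x (t - i) \<omega> $ a * Q (i, a) (j, b) * x (t - j) \<omega> $ b)"
    by (simp add: quad_form_def block_index_def eta_def sum.cartesian_product')
  also have "\<dots> = (\<Sum>i\<le>m. \<Sum>j\<le>m. \<Sum>a\<in>UNIV. \<Sum>b\<in>UNIV.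
      x (t - i) \<omega> $ a * Q (i, a) (j, b) * x (t - j) \<omega> $ b)"
    by (intro sum.cong refl) (rule sum.swap)
  finally show ?thesis
    by (simp add: inner_matrix_vector_sum blk_def)
qed

lemma transpose_blk:
  assumes "sym_psd_on (block_index k) Q" "i \<le> k" "j \<le> k"
  shows "transpose (blk Q i j) = blk Q j i"
  using assms by (auto simp: sym_psd_on_def block_index_def transpose_def blk_def vec_eq_iff)

text \<open>The current state is isolated. By symmetry of \<open>Q\<close> the mixed terms of block
  row 0 and block column 0 agree, whence the factor 2; both indices of the remaining double sum
  start at 1, so for t \<ge> 1 it involves earlier states only.\<close>

lemma zproc_split:
  fixes x :: "nat \<Rightarrow> 'a \<Rightarrow> real^'n"
  assumes "sym_psd_on (block_index k) Q"
  shows "zproc Q k x t \<omega> =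
    x t \<omega> \<bullet> (blk Q 0 0 *v x t \<omega>)
    + 2 * ((\<Sum>i = 1..min k t. blk Q 0 i *v x (t - i) \<omega>) \<bullet> x t \<omega>)
    + (\<Sum>i = 1..min k t. \<Sum>j = 1..min k t. x (t - i) \<omega> \<bullet> (blk Q i j *v x (t - j) \<omega>))"
proof -
  have split: "(\<Sum>i\<le>min k t. f i) = f 0 + (\<Sum>i = 1..min k t. f i)" for f :: "nat \<Rightarrow> real"
    by (simp add: atMost_atLeast0 sum.atLeast_Suc_atMost)
  have "x (t - i) \<omega> \<bullet> (blk Q i 0 *v x t \<omega>) = x t \<omega> \<bullet> (blk Q 0 i *v x (t - i) \<omega>)"
    if "i \<in> {1..min k t}" for i
    using inner_matrix_vector_mult[of "x (t - i) \<omega>" "blk Q i 0" "x t \<omega>"] that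
      transpose_blk[OF assms, of i 0] by (simp add: inner_commute del: transpose_matrix_vector)
  then show ?thesis
    unfolding zproc_def quad_form_block_index
    by (simp add: split sum.distrib inner_sum_left inner_sum_right inner_commute[of _ "x t \<omega>"])
qed

section \<open>Auxiliary facts on the disturbances\<close>

lemma borel_measurable_outer [measurable]:
  assumes "f \<in> borel_measurable M" "g \<in> borel_measurable M"
  shows "(\<lambda>\<omega>. outer (f \<omega>) (g \<omega>)) \<in> borel_measurable M"
  by (rule borel_measurable_continuous_Pair[OF assms])
     (auto simp: outer_def intro!: continuous_intros)

text \<open>Both deviations subtract the same constant vector, so the integrals depend only on the
  laws of the disturbances. The deviation at time \<open>Suc s\<close> comes from
  \<open>w s\<close>.\<close>

lemma integral_dist_dev_cong:
  fixes h :: "real^'n \<Rightarrow> 'b::euclidean_space"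
  assumes "w 0 \<in> borel_measurable M" "w s \<in> borel_measurable M"
    and "distr M borel (w 0) = distr M borel (w s)"
    and h: "h \<in> borel_measurable borel"
  shows "(\<integral>\<omega>. h (dist_dev M w 1 \<omega>) \<partial>M) = (\<integral>\<omega>. h (dist_dev M w (Suc s) \<omega>) \<partial>M)"
proof -
  have h': "(\<lambda>v. h (v - wbar M w)) \<in> borel_measurable borel"
    using h by measurable
  show ?thesis
    using integral_distr[OF assms(1) h'] integral_distr[OF assms(2) h'] assms(3)
    by (simp add: dist_dev_def)
qed

text \<open>The inequality (r + s)^2 \<le> 2 r^2 + 2 s^2 is used twice, which gives the constant 2 *
  2^2 = 8.\<close>

lemma norm_diff_power4_le:
  fixes a b :: "'a::real_normed_vector"
  shows "norm (a - b) ^ 4 \<le> 8 * norm a ^ 4 + 8 * norm b ^ 4"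
proof -
  have sq: "(r + s)\<^sup>2 \<le> 2 * r\<^sup>2 + 2 * s\<^sup>2" for r s :: real
    using sum_squares_bound[of r s] by (simp add: power2_sum)
  have "norm (a - b) ^ 4 \<le> (norm a + norm b) ^ 4"
    by (intro power_mono norm_triangle_ineq4) auto
  also have "\<dots> = ((norm a + norm b)\<^sup>2)\<^sup>2"
    by (simp flip: power_mult)
  also have "\<dots> \<le> (2 * (norm a)\<^sup>2 + 2 * (norm b)\<^sup>2)\<^sup>2"
    by (intro power_mono sq) auto
  also have "\<dots> \<le> 2 * (2 * (norm a)\<^sup>2)\<^sup>2 + 2 * (2 * (norm b)\<^sup>2)\<^sup>2"
    by (rule sq)
  finally show ?thesis
    by (simp add: power_mult_distrib flip: power_mult)
qed

theorem lemma1: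
  fixes M :: "'a measure"
    and A :: "real^'n^'n" and B :: "real^'m^'n"
    and x :: "nat \<Rightarrow> 'a \<Rightarrow> real^'n" and u :: "nat \<Rightarrow> 'a \<Rightarrow> real^'m"
    and w :: "nat \<Rightarrow> 'a \<Rightarrow> real^'n"
    and x0 :: "real^'n"
    and Q :: "nat \<times> 'n \<Rightarrow> nat \<times> 'n \<Rightarrow> real"
    and N k t :: nat
  defines "Q00 \<equiv> blk Q 0 0"
    and "\<Sigma> \<equiv> noise_cov M w"
    and "\<gamma> \<equiv> noise_gamma M w (blk Q 0 0)"
    and "\<theta> \<equiv> noise_theta M w (blk Q 0 0)"
  assumes prob: "prob_space M"
    and N: "1 \<le> N"
    and x_rv: "\<And>s. s \<le> N \<Longrightarrow> x s \<in> borel_measurable M"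
    and u_rv: "\<And>s. s < N \<Longrightarrow> u s \<in> borel_measurable M"
    and w_rv: "\<And>s. s < N \<Longrightarrow> w s \<in> borel_measurable M"
    and dyn: "\<And>s \<omega>. s < N \<Longrightarrow> \<omega> \<in> space M \<Longrightarrow>
                x (Suc s) \<omega> = A *v x s \<omega> + B *v u s \<omega> + w s \<omega>"
    and indep: "prob_space.indep_vars M (\<lambda>_. borel)
                  (\<lambda>i. case i of 0 \<Rightarrow> x 0 | Suc s \<Rightarrow> w s) {..N}"
    and ident: "\<And>r s. r < N \<Longrightarrow> s < N \<Longrightarrow> distr M borel (w r) = distr M borel (w s)"
    and init: "AE \<omega> in M. x 0 \<omega> = x0"
    and k: "k \<le> N"
    and Q_psd: "sym_psd_on (block_index k) Q"
    and A1: "\<And>s. s < N \<Longrightarrow> in_L2 M (hist_algebra M x u s) (u s)"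
    and A2: "\<And>s. s < N \<Longrightarrow> integrable M (\<lambda>\<omega>. (norm (w s \<omega>)) ^ 4)"
    and t: "1 \<le> t" "t \<le> N"
  shows
    "(min k t \<ge> 1 \<longrightarrow>
        (AE \<omega> in M. (Delta M Q k x u t \<omega>)\<^sup>2 =
            Delta1 M Q x u t \<omega> + Delta2 M Q k x w t \<omega> + Delta3 M Q k x u w t \<omega>) \<and>
        integrable M (Delta1 M Q x u t) \<and>
        integrable M (Delta2 M Q k x w t) \<and>
        integrable M (Delta3 M Q k x u w t) \<and>
        (\<integral>\<omega>. Delta1 M Q x u t \<omega> \<partial>M) =
          4 * (\<integral>\<omega>. x t \<omega> \<bullet> ((Q00 ** \<Sigma> ** Q00) *v x t \<omega>) + x t \<omega> \<bullet> (Q00 *v \<gamma>) \<partial>M) + \<theta> \<and>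
        (\<integral>\<omega>. Delta2 M Q k x w t \<omega> \<partial>M) =
          4 * (\<Sum>i = 1..min k t. \<Sum>j = 1..min k t.
                 (\<integral>\<omega>. x (t - i) \<omega> \<bullet> ((blk Q i 0 ** \<Sigma> ** blk Q 0 j) *v x (t - j) \<omega>) \<partial>M)) \<and>
        (\<integral>\<omega>. Delta3 M Q k x u w t \<omega> \<partial>M) =
          4 * (\<Sum>i = 1..min k t.
                 (\<integral>\<omega>. x (t - i) \<omega> \<bullet>
                    (blk Q i 0 *v (\<gamma> + 2 *\<^sub>R ((\<Sigma> ** Q00) *v x t \<omega>))) \<partial>M))) \<and>
     (min k t = 0 \<longrightarrow>
        (\<forall>\<omega>\<in>space M. (Delta M Q k x u t \<omega>)\<^sup>2 = Delta1 M Q x u t \<omega>) \<and>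
        integrable M (Delta1 M Q x u t) \<and>
        (\<integral>\<omega>. (Delta M Q k x u t \<omega>)\<^sup>2 \<partial>M) =
          4 * (\<integral>\<omega>. x t \<omega> \<bullet> ((Q00 ** \<Sigma> ** Q00) *v x t \<omega>) + x t \<omega> \<bullet> (Q00 *v \<gamma>) \<partial>M) + \<theta>)"
proof -

  \<comment> \<open>Square integrability of disturbances, controls and states\<close>
  interpret prob_space M by (rule prob)
  \<comment> \<open>The instance with the full \<sigma>-algebra covers vectors whose measurability
    with respect to the past is not at issue.\<close>
  interpret top: L2_space M M
    by unfold_locales (simp add: subalgebra_def)
  have wL2: "in_L2 M M (w s)" if "s < N" for s
  proof (rule top.in_L2_I)
    show "integrable M (\<lambda>\<omega>. 1 + norm (w s \<omega>) ^ 4)"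
      using A2[OF that] by simp
    show "(norm (w s \<omega>))\<^sup>2 \<le> 1 + norm (w s \<omega>) ^ 4" for \<omega>
    proof -
      have "2 * (norm (w s \<omega>))\<^sup>2 \<le> 1 + norm (w s \<omega>) ^ 4"
        using sum_squares_bound[of "(norm (w s \<omega>))\<^sup>2" 1] by (simp flip: power_mult)
      then show ?thesis
        using zero_le_power2[of "norm (w s \<omega>)"] by linarith
    qed
  qed (use w_rv that in auto)
  have uL2: "in_L2 M M (u s)" if "s < N" for s
    using A1[OF that] u_rv[OF that] by (simp add: in_L2_def)
  have xL2: "in_L2 M M (x s)" if "s \<le> N" for s
    using that
  proof (induction s)
    case 0
    have "integrable M (\<lambda>\<omega>. (norm (x 0 \<omega>))\<^sup>2) \<longleftrightarrow> integrable M (\<lambda>_. (norm x0)\<^sup>2)"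
      using x_rv[of 0] init by (intro integrable_cong_AE) auto
    then show ?case
      using x_rv[of 0] by (simp add: in_L2_def)
  next
    case (Suc s)
    then have "in_L2 M M (\<lambda>\<omega>. A *v x s \<omega> + B *v u s \<omega> + w s \<omega>)"
      by (intro top.in_L2_add top.in_L2_matrix uL2 wL2) auto
    \<comment> \<open>The dynamics hold on \<open>space M\<close> only, so square integrability is
      transferred by domination instead of by rewriting the function.\<close>
    then show ?case
      using Suc.prems dyn
      by (intro top.in_L2_I[OF x_rv, where g = "\<lambda>\<omega>. (norm (A *v x s \<omega> + B *v u s \<omega> + w s \<omega>))\<^sup>2"])
         (auto simp: in_L2_def)
  qed

  \<comment> \<open>The past before time t and the noise independent of it\<close>
  obtain \<tau> where \<tau>: "t = Suc \<tau>"
    using t(1) by (cases t) auto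
  have \<tau>N: "\<tau> < N"
    using t(2) \<tau> by simp
  \<comment> \<open>Since \<open>t = Suc \<tau>\<close>, this is the \<sigma>-algebra at time t - 1,
    and the truncated subtraction in \<open>innov\<close> and \<open>dist_dev\<close> yields
    \<open>\<tau>\<close>.\<close>
  define F where "F = hist_algebra M x u \<tau>"
  define d where "d = dist_dev M w t"
  have d_eq: "d \<omega> = w \<tau> \<omega> - wbar M w" for \<omega>
    by (simp add: d_def dist_dev_def \<tau>)
  have distr: "distr M borel (w 0) = distr M borel (w \<tau>)"
    using \<tau>N by (intro ident) auto
  have w_rv': "w 0 \<in> borel_measurable M" "w \<tau> \<in> borel_measurable M"
    using \<tau>N by (auto intro!: w_rv)
  have d_cong: "(\<integral>\<omega>. h (dist_dev M w 1 \<omega>) \<partial>M) = (\<integral>\<omega>. h (d \<omega>) \<partial>M)"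
    if "h \<in> borel_measurable borel" for h :: "real^'n \<Rightarrow> 'b::euclidean_space"
    unfolding d_def \<tau> by (rule integral_dist_dev_cong[OF w_rv' distr that])
  have subF: "subalgebra M F"
    unfolding F_def using \<tau>N by (intro subalgebra_hist_algebra x_rv u_rv refl) auto
  interpret L2_space M F
    by unfold_locales (rule subF)
  interpret independent_noise M F d
  proof
    show d_rv: "d \<in> borel_measurable M"
      unfolding d_eq[abs_def] using w_rv' by simp
    show "integrable M (\<lambda>\<omega>. norm (d \<omega>) ^ 4)"
    proof (rule Bochner_Integration.integrable_bound)
      show "integrable M (\<lambda>\<omega>. 8 * norm (w \<tau> \<omega>) ^ 4 + 8 * norm (wbar M w) ^ 4)"
        using A2[OF \<tau>N] by simp
    qed (use w_rv' in \<open>auto simp: d_eq norm_diff_power4_le\<close>)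
    have "(\<integral>\<omega>. w 0 \<omega> \<partial>M) = (\<integral>\<omega>. w \<tau> \<omega> \<partial>M)"
      using integral_distr[OF w_rv'(1), of "\<lambda>v. v"] integral_distr[OF w_rv'(2), of "\<lambda>v. v"] distr
      by simp
    then show "(\<integral>\<omega>. d \<omega> \<partial>M) = 0"
      using top.in_L2_integrable[OF wL2[OF \<tau>N]] by (simp add: d_eq wbar_def prob_space)
    fix X :: "'a \<Rightarrow> real" and g :: "real^'n \<Rightarrow> real"
    assume X: "X \<in> borel_measurable F" and g: "g \<in> borel_measurable borel"
    \<comment> \<open>A function of the deviation is a shifted function of the disturbance
      itself.\<close>
    have "indep_var borel X borel (\<lambda>\<omega>. (\<lambda>v. g (v - wbar M w)) (w \<tau> \<omega>))"
    proof (rule hist_algebra_indep_disturbance[OF dyn indep _ \<tau>N X[unfolded F_def]])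
      show "(\<lambda>v. g (v - wbar M w)) \<in> borel_measurable borel"
        using g by measurable
    qed (use A1 in \<open>auto simp: in_L2_def\<close>)
    then show "indep_var borel X borel (\<lambda>\<omega>. g (d \<omega>))"
      by (simp add: d_eq)
  qed

  \<comment> \<open>Identification of the noise statistics with the moments of
    \<open>d\<close>\<close>
  define m where "m = min k t"
  have Q00_sym: "transpose Q00 = Q00"
    unfolding Q00_def by (rule transpose_blk[OF Q_psd]) auto
  have cov: "\<Sigma> = cov"
    unfolding \<Sigma>_def noise_cov_def cov_def by (rule d_cong) measurable
  have third: "\<gamma> = third Q00"
    unfolding \<gamma>_def noise_gamma_def third_def outer_matrix_vector_mult Q00_def[symmetric]
    by (rule d_cong) measurable
  \<comment> \<open>The mean inside the variance is made a constant first; the integrand of the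
    variance is then a function of the deviation alone and \<open>d_cong\<close> applies.\<close>
  have q_mean: "(\<integral>\<omega>. dist_dev M w 1 \<omega> \<bullet> (Q00 *v dist_dev M w 1 \<omega>) \<partial>M) = quad_mean Q00"
    unfolding quad_mean_def by (rule d_cong) measurable
  have delta: "noise_delta M w Q00 = variance (\<lambda>\<omega>. d \<omega> \<bullet> (Q00 *v d \<omega>))"
    unfolding noise_delta_def q_mean quad_mean_def[symmetric] by (rule d_cong) measurable
  have theta: "\<theta> = variance (\<lambda>\<omega>. d \<omega> \<bullet> (Q00 *v d \<omega>)) - 4 * trace ((cov ** Q00) ** (cov ** Q00))"
    unfolding \<theta>_def noise_theta_def Q00_def[symmetric] delta \<Sigma>_def[symmetric] cov ..

  \<comment> \<open>Splitting of the state and the coupling vector \<open>s\<close>\<close>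
  define v where "v \<omega> = A *v x \<tau> \<omega> + B *v u \<tau> \<omega> + wbar M w" for \<omega>
  have x_t: "x t \<omega> = v \<omega> + d \<omega>" if "\<omega> \<in> space M" for \<omega>
    using dyn[OF \<tau>N that] by (simp add: \<tau> v_def d_eq)
  have xF: "in_L2 M F (x i)" if "i \<le> \<tau>" for i
    using xL2[of i] that \<tau>N measurable_hist_algebra_state[OF that, of x M u]
    by (simp add: in_L2_def F_def)
  have v: "in_L2 M F v"
    unfolding v_def using A1[OF \<tau>N]
    by (intro in_L2_add in_L2_matrix in_L2_const xF) (auto simp: F_def)
  define p where "p i \<omega> = blk Q 0 i *v x (t - i) \<omega>" for i \<omega>
  define s where "s \<omega> = (\<Sum>i = 1..m. p i \<omega>)" for \<omega>
  \<comment> \<open>The lower bound 1 on \<open>i\<close> keeps the state within the history up to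
    \<open>\<tau>\<close>.\<close>
  have x_past: "in_L2 M F (x (t - i))" if "i \<in> {1..m}" for i
    using that by (intro xF) (auto simp: \<tau>)
  have p: "in_L2 M F (p i)" if "i \<in> {1..m}" for i
    unfolding p_def by (intro in_L2_matrix x_past that)
  have s: "in_L2 M F s"
    unfolding s_def by (intro in_L2_sum p)
  have p_inner: "x (t - i) \<omega> \<bullet> (blk Q i 0 *v b) = p i \<omega> \<bullet> b" if "i \<in> {1..m}" for i \<omega> b
    using that transpose_blk[OF Q_psd, of i 0]
    by (simp add: inner_matrix_vector_mult p_def m_def)
  have s_inner: "(\<Sum>i = 1..m. x (t - i) \<omega> \<bullet> (blk Q i 0 *v b)) = s \<omega> \<bullet> b" for \<omega> b
    by (simp add: s_def inner_sum_left p_inner)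

  \<comment> \<open>Explicit versions of the innovations, valid almost surely\<close>
  let ?Y = "\<lambda>\<omega>. 2 * ((Q00 *v v \<omega>) \<bullet> d \<omega>) + cquad Q00 \<omega>"
  have Qv: "in_L2 M F (\<lambda>\<omega>. Q00 *v v \<omega>)"
    by (rule in_L2_matrix[OF v])
  have x_quad: "x t \<omega> \<bullet> (Q00 *v x t \<omega>) =
      v \<omega> \<bullet> (Q00 *v v \<omega>) + (2 *\<^sub>R (Q00 *v v \<omega>)) \<bullet> d \<omega> + d \<omega> \<bullet> (Q00 *v d \<omega>)"
    if "\<omega> \<in> space M" for \<omega>
    using inner_matrix_vector_mult[of "v \<omega>" Q00 "d \<omega>"] Q00_sym
    by (simp add: x_t[OF that] matrix_vector_right_distrib inner_add_left inner_add_right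
        inner_commute[of "d \<omega>" "Q00 *v v \<omega>"])
  have Y: "AE \<omega> in M. yproc M Q x u t \<omega> = ?Y \<omega>"
  proof -
    have r: "in_L2 M F (\<lambda>\<omega>. 2 *\<^sub>R (Q00 *v v \<omega>))"
      by (rule in_L2_scaleR[OF Qv])
    have f: "(\<lambda>\<omega>. v \<omega> \<bullet> (Q00 *v v \<omega>)) \<in> borel_measurable F"
      by (intro borel_measurable_inner in_L2_measurable v Qv)
    have "AE \<omega> in M. x t \<omega> \<bullet> (Q00 *v x t \<omega>) - real_cond_exp M F (\<lambda>\<omega>. x t \<omega> \<bullet> (Q00 *v x t \<omega>)) \<omega> =
        (2 *\<^sub>R (Q00 *v v \<omega>)) \<bullet> d \<omega> + d \<omega> \<bullet> (Q00 *v d \<omega>) - quad_mean Q00"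
      by (rule real_cond_exp_affine_quad_noise[OF f integrable_inner_L2[OF v Qv]
            in_L2_measurable[OF r] in_L2_integrable[OF r] x_quad])
    then show ?thesis
      by eventually_elim (simp add: yproc_def innov_def F_def \<tau> Q00_def)
  qed
  have Z: "AE \<omega> in M. Delta M Q k x u t \<omega> = ?Y \<omega> + 2 * (s \<omega> \<bullet> d \<omega>)"
  proof -
    \<comment> \<open>The coupling term \<open>2 * (s \<bullet> x t)\<close> is divided between the
      coefficient \<open>?r\<close> of the noise and the part \<open>?f\<close> determined by the
      past.\<close>
    let ?r = "\<lambda>\<omega>. 2 *\<^sub>R (Q00 *v v \<omega>) + 2 *\<^sub>R s \<omega>"
    let ?past = "\<lambda>\<omega>. \<Sum>i = 1..m. \<Sum>j = 1..m. x (t - i) \<omega> \<bullet> (blk Q i j *v x (t - j) \<omega>)"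
    let ?f = "\<lambda>\<omega>. v \<omega> \<bullet> (Q00 *v v \<omega>) + 2 * (s \<omega> \<bullet> v \<omega>) + ?past \<omega>"
    have r: "in_L2 M F ?r"
      by (intro in_L2_add in_L2_scaleR Qv s)
    have f: "?f \<in> borel_measurable F"
      by (intro borel_measurable_add borel_measurable_times borel_measurable_const
          borel_measurable_sum borel_measurable_inner in_L2_measurable in_L2_matrix x_past v Qv s)
    have fi: "integrable M ?f"
      by (intro Bochner_Integration.integrable_add integrable_mult_right
          Bochner_Integration.integrable_sum integrable_inner_L2 in_L2_matrix x_past v s)
    have z: "zproc Q k x t \<omega> = ?f \<omega> + ?r \<omega> \<bullet> d \<omega> + d \<omega> \<bullet> (Q00 *v d \<omega>)" if "\<omega> \<in> space M" for \<omega>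
    proof -
      have "zproc Q k x t \<omega> = x t \<omega> \<bullet> (Q00 *v x t \<omega>) + 2 * (s \<omega> \<bullet> x t \<omega>) + ?past \<omega>"
        unfolding zproc_split[OF Q_psd] s_def p_def m_def Q00_def ..
      then show ?thesis
        unfolding x_quad[OF that] by (simp add: x_t[OF that] inner_add_left inner_add_right)
    qed
    have "AE \<omega> in M. zproc Q k x t \<omega> - real_cond_exp M F (zproc Q k x t) \<omega> =
        ?r \<omega> \<bullet> d \<omega> + d \<omega> \<bullet> (Q00 *v d \<omega>) - quad_mean Q00"
      by (rule real_cond_exp_affine_quad_noise[OF f fi in_L2_measurable[OF r] in_L2_integrable[OF r] z])
    then show ?thesis
      by eventually_elim (simp add: Delta_def innov_def F_def \<tau> inner_add_left)
  qed

  \<comment> \<open>An almost sure identity does not by itself give measurability, as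
    \<open>M\<close> may be incomplete. It is secured here because transferring integrals along such
    identities requires it.\<close>
  have y_rv: "yproc M Q x u t \<in> borel_measurable M"
  proof -
    have "real_cond_exp M F f \<in> borel_measurable M" for f
      by (rule measurable_F_M) simp
    moreover have "x t \<in> borel_measurable M"
      by (rule x_rv[OF t(2)])
    ultimately show ?thesis
      unfolding yproc_def innov_def[abs_def] by (simp add: F_def \<tau>)
  qed
  have lin_rv: "(\<lambda>\<omega>. a \<omega> \<bullet> d \<omega>) \<in> borel_measurable M" if "in_L2 M F a" for a
    using measurable_F_M[OF in_L2_measurable[OF that]] by simp
  have Y_rv: "?Y \<in> borel_measurable M"
    using lin_rv[OF Qv] by simp

  \<comment> \<open>The three terms: decomposition, integrability and expectations\<close>
  have D2_eq: "Delta2 M Q k x w t \<omega> = 4 * ((s \<omega> \<bullet> d \<omega>) * (s \<omega> \<bullet> d \<omega>))" for \<omega>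
    unfolding Delta2_def m_def[symmetric] d_def[symmetric] s_inner power2_eq_square ..
  have D3_eq: "Delta3 M Q k x u w t \<omega> = 4 * ((s \<omega> \<bullet> d \<omega>) * yproc M Q x u t \<omega>)" for \<omega>
    unfolding Delta3_def m_def[symmetric] d_def[symmetric] sum_distrib_right[symmetric] s_inner ..
  have D1_ae: "AE \<omega> in M. Delta1 M Q x u t \<omega> = (?Y \<omega>)\<^sup>2"
    using Y by eventually_elim (simp add: Delta1_def)
  have D3_ae: "AE \<omega> in M. Delta3 M Q k x u w t \<omega> = 4 * ((s \<omega> \<bullet> d \<omega>) * ?Y \<omega>)"
    using Y by eventually_elim (simp add: D3_eq)
  have D1_rv: "Delta1 M Q x u t \<in> borel_measurable M"
    unfolding Delta1_def[abs_def] using y_rv by simp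
  have D3_rv: "Delta3 M Q k x u w t \<in> borel_measurable M"
    unfolding D3_eq[abs_def] using y_rv lin_rv[OF s] by simp

  have decomp: "AE \<omega> in M. (Delta M Q k x u t \<omega>)\<^sup>2 =
      Delta1 M Q x u t \<omega> + Delta2 M Q k x w t \<omega> + Delta3 M Q k x u w t \<omega>"
    using Y Z
  proof eventually_elim
    case (elim \<omega>)
    \<comment> \<open>Squaring this sum gives the three terms, the cross product being the
      third.\<close>
    have "Delta M Q k x u t \<omega> = yproc M Q x u t \<omega> + 2 * (s \<omega> \<bullet> d \<omega>)"
      using elim by simp
    then show ?case
      by (simp add: D2_eq D3_eq Delta1_def power2_eq_square algebra_simps)
  qed
  have D1_int: "integrable M (Delta1 M Q x u t)"
    using integrable_innovation_square[OF Q00_sym v] Y_rv D1_rv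
    by (subst integrable_cong_AE[OF _ _ D1_ae]) auto
  have D2_int: "integrable M (Delta2 M Q k x w t)"
    unfolding D2_eq[abs_def] using integrable_linear_noise_mult[OF s s] by simp
  have D3_int: "integrable M (Delta3 M Q k x u w t)"
    using integrable_linear_innovation[OF Q00_sym v s] Y_rv D3_rv lin_rv[OF s]
    by (subst integrable_cong_AE[OF _ _ D3_ae]) auto
  have D1_val: "(\<integral>\<omega>. Delta1 M Q x u t \<omega> \<partial>M) =
      4 * (\<integral>\<omega>. x t \<omega> \<bullet> ((Q00 ** \<Sigma> ** Q00) *v x t \<omega>) + x t \<omega> \<bullet> (Q00 *v \<gamma>) \<partial>M) + \<theta>"
  proof -
    have "(\<integral>\<omega>. Delta1 M Q x u t \<omega> \<partial>M) = (\<integral>\<omega>. (?Y \<omega>)\<^sup>2 \<partial>M)"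
      using Y_rv D1_rv by (intro integral_cong_AE D1_ae) auto
    also have "\<dots> = 4 * (\<integral>\<omega>. (v \<omega> + d \<omega>) \<bullet> ((Q00 ** cov ** Q00) *v (v \<omega> + d \<omega>))
        + (v \<omega> + d \<omega>) \<bullet> (Q00 *v third Q00) \<partial>M) + \<theta>"
      unfolding theta by (rule integral_innovation_square[OF Q00_sym v])
    also have "(\<integral>\<omega>. (v \<omega> + d \<omega>) \<bullet> ((Q00 ** cov ** Q00) *v (v \<omega> + d \<omega>))
        + (v \<omega> + d \<omega>) \<bullet> (Q00 *v third Q00) \<partial>M) =
        (\<integral>\<omega>. x t \<omega> \<bullet> ((Q00 ** \<Sigma> ** Q00) *v x t \<omega>) + x t \<omega> \<bullet> (Q00 *v \<gamma>) \<partial>M)"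
      unfolding cov third by (rule Bochner_Integration.integral_cong) (simp_all add: x_t)
    finally show ?thesis .
  qed
  have D2_val: "(\<integral>\<omega>. Delta2 M Q k x w t \<omega> \<partial>M) =
      4 * (\<Sum>i = 1..m. \<Sum>j = 1..m.
        (\<integral>\<omega>. x (t - i) \<omega> \<bullet> ((blk Q i 0 ** \<Sigma> ** blk Q 0 j) *v x (t - j) \<omega>) \<partial>M))"
  proof -
    \<comment> \<open>The range of \<open>i\<close> enters through the symmetry of \<open>Q\<close>,
      which turns block (i, 0) into block (0, i); on the right, \<open>p j\<close> appears by its
      definition.\<close>
    have eq: "x (t - i) \<omega> \<bullet> ((blk Q i 0 ** \<Sigma> ** blk Q 0 j) *v x (t - j) \<omega>) =
        p i \<omega> \<bullet> (cov *v p j \<omega>)" if "i \<in> {1..m}" for i j \<omega>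
      using p_inner[OF that, of \<omega> "cov *v p j \<omega>"]
      by (simp add: p_def[of j] cov matrix_vector_mul_assoc matrix_mul_assoc)
    have int: "integrable M (\<lambda>\<omega>. p i \<omega> \<bullet> (cov *v p j \<omega>))" if "i \<in> {1..m}" "j \<in> {1..m}" for i j
      by (intro integrable_inner_L2 in_L2_matrix p that)
    have "(\<integral>\<omega>. Delta2 M Q k x w t \<omega> \<partial>M) = 4 * (\<integral>\<omega>. s \<omega> \<bullet> (cov *v s \<omega>) \<partial>M)"
      unfolding D2_eq using integral_linear_noise_mult[OF s s] by simp
    also have "(\<lambda>\<omega>. s \<omega> \<bullet> (cov *v s \<omega>)) =
        (\<lambda>\<omega>. \<Sum>i = 1..m. \<Sum>j = 1..m. p i \<omega> \<bullet> (cov *v p j \<omega>))"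
      unfolding s_def linear_sum[OF matrix_vector_mul_linear] inner_sum_left
      by (simp only: inner_sum_right)
    also have "(\<integral>\<omega>. (\<Sum>i = 1..m. \<Sum>j = 1..m. p i \<omega> \<bullet> (cov *v p j \<omega>)) \<partial>M) =
        (\<Sum>i = 1..m. \<Sum>j = 1..m. (\<integral>\<omega>. p i \<omega> \<bullet> (cov *v p j \<omega>) \<partial>M))"
      by (subst Bochner_Integration.integral_sum, intro Bochner_Integration.integrable_sum int)
         (auto intro!: sum.cong Bochner_Integration.integral_sum int simp del: One_nat_def)
    finally show ?thesis
      by (simp add: eq)
  qed
  have D3_val: "(\<integral>\<omega>. Delta3 M Q k x u w t \<omega> \<partial>M) =
      4 * (\<Sum>i = 1..m. (\<integral>\<omega>. x (t - i) \<omega> \<bullet>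
        (blk Q i 0 *v (\<gamma> + 2 *\<^sub>R ((\<Sigma> ** Q00) *v x t \<omega>))) \<partial>M))"
  proof -
    let ?g = "\<lambda>\<omega>. third Q00 + 2 *\<^sub>R ((cov ** Q00) *v (v \<omega> + d \<omega>))"
    have "(\<integral>\<omega>. Delta3 M Q k x u w t \<omega> \<partial>M) = (\<integral>\<omega>. 4 * ((s \<omega> \<bullet> d \<omega>) * ?Y \<omega>) \<partial>M)"
      using Y_rv D3_rv lin_rv[OF s] by (intro integral_cong_AE D3_ae) auto
    also have "\<dots> = 4 * (\<integral>\<omega>. s \<omega> \<bullet> ?g \<omega> \<partial>M)"
      using integral_linear_innovation[OF Q00_sym v s] by simp
    also have "(\<lambda>\<omega>. s \<omega> \<bullet> ?g \<omega>) = (\<lambda>\<omega>. \<Sum>i = 1..m. p i \<omega> \<bullet> ?g \<omega>)"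
      unfolding s_def inner_sum_left ..
    \<comment> \<open>Exchanging sum and integral needs each summand integrable; this is
      \<open>integrable_linear_gamma\<close> with \<open>p i\<close> in the role of
      \<open>s\<close>.\<close>
    also have "(\<integral>\<omega>. (\<Sum>i = 1..m. p i \<omega> \<bullet> ?g \<omega>) \<partial>M) = (\<Sum>i = 1..m. (\<integral>\<omega>. p i \<omega> \<bullet> ?g \<omega> \<partial>M))"
      by (intro Bochner_Integration.integral_sum integrable_linear_gamma[OF Q00_sym v p])
    also have "\<dots> = (\<Sum>i = 1..m. (\<integral>\<omega>. x (t - i) \<omega> \<bullet>
        (blk Q i 0 *v (\<gamma> + 2 *\<^sub>R ((\<Sigma> ** Q00) *v x t \<omega>))) \<partial>M))"
      by (intro sum.cong Bochner_Integration.integral_cong refl)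
         (simp only: p_inner cov third x_t)
    finally show ?thesis .
  qed
  \<comment> \<open>Without coupling the two innovations belong to the same function, so they agree
    at every point and not just almost surely.\<close>
  have Delta_yproc: "Delta M Q k x u t = yproc M Q x u t" if "m = 0"
  proof -
    have "zproc Q k x t = (\<lambda>\<omega>. x t \<omega> \<bullet> (blk Q 0 0 *v x t \<omega>))"
      using that by (simp add: fun_eq_iff zproc_def quad_form_block_index m_def)
    then show ?thesis
      by (simp add: Delta_def yproc_def)
  qed
  then have "(Delta M Q k x u t \<omega>)\<^sup>2 = Delta1 M Q x u t \<omega>" if "m = 0" for \<omega>
    using that by (simp add: Delta1_def)
  then show ?thesis
    using decomp D1_int D2_int D3_int D1_val D2_val D3_val by (auto simp flip: m_def)
qed

end
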